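(* $\mathbf{D}$ is a metric on $\mathcal{P}(\mathbb{R}^m)/\!\sim$ (where the value $+\infty$ is allowed for $\mathbf{D}$).
   Context: **Atomic measures.** A (finite) atomic measure on $\mathbb{R}^m$ is $\mathbf{a}=\sum_{i=1}^k m_i\delta_{x_i}$ with distinct $x_i\in\mathbb{R}^m$ and $m_i>0$; its mass is $\|\mathbf{a}\|=\sum_i m_i$. **Transport paths.** For atomic measures $\mathbf{a}=\sum_{i=1}^k m_i\delta_{x_i}$, $\mathbf{b}=\sum_{j=1}^\ell n_j\delta_{y_j}$ of equal mass, a transport path from $\mathbf{a}$ to $\mathbf{b}$ is a finite weighted directed graph $G$ with vertex set $V(G)\subset\mathbb{R}^m$ containing all $x_i,y_j$, directed edge set $E(G)$ (straight segments) and weights $w:E(G)\to(0,\infty)$ such that at each vertex $v$ $$\sum_{e^-=v}w(e)=\sum_{e^+=v}w(e)+(m_i\text{ if }v=x_i)+(-n_j\text{ if }v=y_j),$$ where $e^-,e^+$ are the start and end points of $e$ (both extra terms occur if $v=x_i=y_j$). Let $Path(\mathbf{a},\mathbf{b})$ be the set of these. When $\alpha<0$ the following convention is adopted: whenever a directed chain of edges of positive length starts and ends at the same point $v$, its end vertex is viewed as a different copy of $v$, and the balance equation must hold separately at each copy. Precisely, for $\alpha<0$: $V(G)$ is a finite abstract set with a position map to $\mathbb{R}^m$, edges join vertices with distinct positions, $G$ has no directed cycles, each $x_i$ is assigned a single vertex $s_i$ at position $x_i$ and each $y_j$ a single vertex $t_j$ at position $y_j$ ($s_i=t_j$ is allowed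 if $x_i=y_j$), and the balance equation holds at each vertex with extra term $+m_i$ at $s_i$ and $-n_j$ at $t_j$. In particular $w(e)\le\|\mathbf{a}\|$ for every edge. For $\alpha\le1$, $\mathbf{M}_\alpha(G)=\sum_{e\in E(G)}w(e)^\alpha\,\mathrm{length}(e)$. **$\mathcal{D}_\alpha$.** Let $\alpha<1$. A sequence $\mathbf{a}_k=\sum_{i=1}^{N_k}m_i^{(k)}\delta_{x_i^{(k)}}$ of atomic measures of equal total mass is a $d_\alpha$-admissible Cauchy sequence if for every $\epsilon>0$ there is $N$ such that for all $n>k\ge N$ there are a partition $\mathbf{a}_n=\sum_{i=1}^{N_k}\mathbf{a}_{n,i}^{(k)}$ into disjoint atomic measures (pairwise disjoint supports) with $\|\mathbf{a}_{n,i}^{(k)}\|=m_i^{(k)}$, and paths $G_{n,i}^k\in Path(m_i^{(k)}\delta_{x_i^{(k)}},\mathbf{a}_{n,i}^{(k)})$ with $\sum_{i=1}^{N_k}\mathbf{M}_\alpha(G_{n,i}^k)\le\epsilon$. $\mathcal{D}_\alpha(\mathbb{R}^m)$ is the set of probability measures $\mu$ on $\mathbb{R}^m$ represented by a $d_\alpha$-admissible Cauchy sequence of atomic probability measures (i.e. the sequence converges weakly to $\mu$). **The distance.** $\mathcal{P}(\mathbb{R}^m)$ is the space of probability measures on $\mathbb{R}^m$. For $\alpha<1$ let $\mathcal{S}_\alpha(\mathbb{R}^m)=\{\Lambda(\mu-\nu):\Lambda\ge0,\ \mu,\nu\in\mathcal{D}_\alpha(\mathbb{R}^m)\}$ (a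 collection of signed measures). For probability measures $\mu,\nu$ on $\mathbb{R}^m$, $D(\mu,\nu)=\inf_{\alpha<1}\{\frac1{1-\alpha}:\mu-\nu\in\mathcal{S}_\alpha(\mathbb{R}^m)\}$, with $\inf\emptyset=+\infty$. Write $\mu\sim\nu$ if $D(\mu,\nu)=0$, let $[\mu]$ be the equivalence class of $\mu$, and $\mathbf{D}([\mu],[\nu])=D(\mu,\nu)$. *)

theory Defs
  imports "HOL-Probability.Probability"
begin

section \<open>Atomic measures\<close>

text \<open>
  The finite atomic measure with masses \<open>m\<^sub>i > 0\<close> at the distinct points \<open>x\<^sub>i\<close> is represented by
  its mass function, which is \<open>m\<^sub>i\<close> at \<open>x\<^sub>i\<close> and \<open>0\<close> elsewhere. Indices \<open>i\<close> become points of the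
  support.
\<close>

definition supp :: "('a \<Rightarrow> real) \<Rightarrow> 'a set" where
  "supp a = {x. a x \<noteq> 0}"

definition atomic :: "('a \<Rightarrow> real) \<Rightarrow> bool" where
  "atomic a \<longleftrightarrow> finite (supp a) \<and> (\<forall>x. a x \<ge> 0)"

definition mass :: "('a \<Rightarrow> real) \<Rightarrow> real" where
  "mass a = (\<Sum>x\<in>supp a. a x)"

definition point_atom :: "real \<Rightarrow> 'a \<Rightarrow> 'a \<Rightarrow> real" where
  "point_atom m x = (\<lambda>y. if y = x then m else 0)"

definition atomic_measure :: "('a::topological_space \<Rightarrow> real) \<Rightarrow> 'a measure" where
  "atomic_measure a = distr (point_measure (supp a) (\<lambda>x. ennreal (a x))) borel (\<lambda>x. x)"


section \<open>Transport paths\<close>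

record 'v wdigraph =
  verts :: "'v set"
  edges :: "('v \<times> 'v) set"
  weight :: "'v \<times> 'v \<Rightarrow> real"

definition wdigraph :: "'v wdigraph \<Rightarrow> bool" where
  "wdigraph G \<longleftrightarrow> finite (verts G) \<and> edges G \<subseteq> verts G \<times> verts G \<and> (\<forall>e\<in>edges G. weight G e > 0)"

definition balanced :: "'v wdigraph \<Rightarrow> ('v \<Rightarrow> real) \<Rightarrow> ('v \<Rightarrow> real) \<Rightarrow> bool" where
  "balanced G source sink \<longleftrightarrow> (\<forall>v\<in>verts G.
     (\<Sum>e\<in>{e \<in> edges G. fst e = v}. weight G e)
       = (\<Sum>e\<in>{e \<in> edges G. snd e = v}. weight G e) + source v - sink v)"

definition M_cost :: "real \<Rightarrow> ('v \<Rightarrow> 'a::metric_space) \<Rightarrow> 'v wdigraph \<Rightarrow> real" where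
  "M_cost \<alpha> pos G = (\<Sum>e\<in>edges G. weight G e powr \<alpha> * dist (pos (fst e)) (pos (snd e)))"

text \<open>Transport paths for \<open>\<alpha> \<ge> 0\<close>: the vertices are points of the space.\<close>

definition transport_paths :: "('a \<Rightarrow> real) \<Rightarrow> ('a \<Rightarrow> real) \<Rightarrow> 'a wdigraph set" where
  "transport_paths a b =
     {G. wdigraph G \<and> supp a \<subseteq> verts G \<and> supp b \<subseteq> verts G \<and> balanced G a b}"

text \<open>
  Transport paths for \<open>\<alpha> < 0\<close>: the vertex \<open>(x, i)\<close> is copy number \<open>i\<close> of the point \<open>x\<close>, so that
  \<open>fst\<close> is the position map. Up to renaming of vertices, every finite abstract vertex set with a
  position map is of this form.
\<close>

definition copy_transport_paths ::
    "('a \<Rightarrow> real) \<Rightarrow> ('a \<Rightarrow> real) \<Rightarrow> ('a \<times> nat) wdigraph set" where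
  "copy_transport_paths a b =
     {G. wdigraph G \<and> (\<forall>(u, v)\<in>edges G. fst u \<noteq> fst v) \<and> acyclic (edges G) \<and>
        (\<exists>s t. (\<forall>x\<in>supp a. s x \<in> verts G \<and> fst (s x) = x) \<and>
               (\<forall>y\<in>supp b. t y \<in> verts G \<and> fst (t y) = y) \<and>
               balanced G (\<lambda>v. \<Sum>x\<in>{x \<in> supp a. s x = v}. a x)
                          (\<lambda>v. \<Sum>y\<in>{y \<in> supp b. t y = v}. b y))}"


section \<open>Admissible Cauchy sequences\<close>

text \<open>
  \<open>p x\<close> is the piece of \<open>b\<close> that is assigned to the atom \<open>x\<close> of \<open>a\<close>.
\<close>

definition atomic_partition ::
    "('a \<Rightarrow> real) \<Rightarrow> ('a \<Rightarrow> real) \<Rightarrow> ('a \<Rightarrow> 'a \<Rightarrow> real) \<Rightarrow> bool" where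
  "atomic_partition a b p \<longleftrightarrow>
     (\<forall>x\<in>supp a. atomic (p x) \<and> mass (p x) = a x) \<and>
     (\<forall>x\<in>supp a. \<forall>x'\<in>supp a. x \<noteq> x' \<longrightarrow> supp (p x) \<inter> supp (p x') = {}) \<and>
     b = (\<lambda>y. \<Sum>x\<in>supp a. p x y)"

definition refines_within ::
    "real \<Rightarrow> real \<Rightarrow> ('a::metric_space \<Rightarrow> real) \<Rightarrow> ('a \<Rightarrow> real) \<Rightarrow> bool" where
  "refines_within \<alpha> \<epsilon> a b \<longleftrightarrow> (\<exists>p. atomic_partition a b p \<and>
     (if \<alpha> \<ge> 0
      then \<exists>G. (\<forall>x\<in>supp a. G x \<in> transport_paths (point_atom (a x) x) (p x)) \<and>
               (\<Sum>x\<in>supp a. M_cost \<alpha> (\<lambda>v. v) (G x)) \<le> \<epsilon>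
      else \<exists>G. (\<forall>x\<in>supp a. G x \<in> copy_transport_paths (point_atom (a x) x) (p x)) \<and>
               (\<Sum>x\<in>supp a. M_cost \<alpha> fst (G x)) \<le> \<epsilon>))"

definition admissible_Cauchy :: "real \<Rightarrow> (nat \<Rightarrow> 'a::metric_space \<Rightarrow> real) \<Rightarrow> bool" where
  "admissible_Cauchy \<alpha> a \<longleftrightarrow>
     (\<forall>k. atomic (a k)) \<and> (\<forall>k l. mass (a k) = mass (a l)) \<and>
     (\<forall>\<epsilon>>0. \<exists>N. \<forall>k\<ge>N. \<forall>n>k. refines_within \<alpha> \<epsilon> (a k) (a n))"

definition converges_weakly ::
    "(nat \<Rightarrow> 'a::topological_space measure) \<Rightarrow> 'a measure \<Rightarrow> bool" where
  "converges_weakly M \<mu> \<longleftrightarrow> (\<forall>f :: 'a \<Rightarrow> real. continuous_on UNIV f \<and> bounded (range f) \<longrightarrow>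
     (\<lambda>k. integral\<^sup>L (M k) f) \<longlonglongrightarrow> integral\<^sup>L \<mu> f)"

definition borel_probs :: "'a::topological_space measure set" where
  "borel_probs = {\<mu>. prob_space \<mu> \<and> sets \<mu> = sets borel}"

definition D_space :: "real \<Rightarrow> 'a::metric_space measure set" where
  "D_space \<alpha> = {\<mu> \<in> borel_probs. \<exists>a. admissible_Cauchy \<alpha> a \<and> (\<forall>k. mass (a k) = 1) \<and>
     converges_weakly (\<lambda>k. atomic_measure (a k)) \<mu>}"


section \<open>The distance\<close>

text \<open>
  Signed measures are real-valued set functions. Since \<open>measure \<mu> A = 0\<close> for every non-measurable
  \<open>A\<close>, two differences of Borel measures are equal as soon as they agree on the Borel sets.
\<close>

definition measure_diff :: "'a measure \<Rightarrow> 'a measure \<Rightarrow> 'a set \<Rightarrow> real" where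
  "measure_diff \<mu> \<nu> = (\<lambda>A. measure \<mu> A - measure \<nu> A)"

definition S_space :: "real \<Rightarrow> ('a::metric_space set \<Rightarrow> real) set" where
  "S_space \<alpha> = {(\<lambda>A. \<Lambda> * measure_diff \<mu> \<nu> A) | \<Lambda> \<mu> \<nu>. \<Lambda> \<ge> 0 \<and> \<mu> \<in> D_space \<alpha> \<and> \<nu> \<in> D_space \<alpha>}"

definition dim_dist :: "'a::metric_space measure \<Rightarrow> 'a measure \<Rightarrow> ennreal" where
  "dim_dist \<mu> \<nu> = (INF \<alpha>\<in>{\<alpha>. \<alpha> < 1 \<and> measure_diff \<mu> \<nu> \<in> S_space \<alpha>}. ennreal (1 / (1 - \<alpha>)))"

definition dim_rel :: "('a::metric_space measure \<times> 'a measure) set" where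
  "dim_rel = {(\<mu>, \<nu>). \<mu> \<in> borel_probs \<and> \<nu> \<in> borel_probs \<and> dim_dist \<mu> \<nu> = 0}"

text \<open>
  The distance of two classes is the common value of \<open>dim_dist\<close> on their representatives.
\<close>

definition class_dist :: "'a::metric_space measure set \<Rightarrow> 'a measure set \<Rightarrow> ennreal" where
  "class_dist X Y = the_elem (\<Union>\<mu>\<in>X. \<Union>\<nu>\<in>Y. {dim_dist \<mu> \<nu>})"

definition extended_metric_on :: "'b set \<Rightarrow> ('b \<Rightarrow> 'b \<Rightarrow> ennreal) \<Rightarrow> bool" where
  "extended_metric_on S d \<longleftrightarrow>
     (\<forall>x\<in>S. \<forall>y\<in>S. d x y = 0 \<longleftrightarrow> x = y) \<and>
     (\<forall>x\<in>S. \<forall>y\<in>S. d x y = d y x) \<and>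
     (\<forall>x\<in>S. \<forall>y\<in>S. \<forall>z\<in>S. d x z \<le> d x y + d y z)"

end

theory Submission
  imports Defs
begin

text \<open>
  The distance satisfies the ultrametric inequality, because the sets \<open>S_space \<alpha>\<close> increase with
  \<open>\<alpha>\<close> and are closed under addition; symmetry and \<open>dim_dist \<mu> \<mu> = 0\<close> are then immediate.
  Both facts are statements about \<open>D_space \<alpha>\<close>: it increases with \<open>\<alpha>\<close> and it is convex.

  They are proved for acyclic paths on copies of points, for all \<open>\<alpha> < 1\<close> at once. For
  \<open>0 \<le> \<alpha>\<close> this notion gives the same costs as paths on points: removing cycles only lowers
  weights, and merging copies is harmless since \<open>w powr \<alpha>\<close> is subadditive in \<open>w\<close>. In an acyclic
  path every weight is at most the transported mass, hence at most \<open>1\<close>, so \<open>w powr \<alpha>\<close> decreases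
  in \<open>\<alpha>\<close>. For convexity one takes convex combinations of the approximating atomic measures, after
  a small translation that makes their supports disjoint.
\<close>

section \<open>Flows on directed graphs\<close>

text \<open>The exponent \<alpha> may be arbitrarily negative, and this shapes the proof. Since 1/(1
  - \<alpha>) tends to 0 only as \<alpha> tends to minus infinity,
  \<open>dim_dist \<mu> \<mu> = 0\<close> requires every \<open>D_space \<alpha>\<close> to be
  nonempty; Dirac measures provide this. For negative \<alpha> light edges are the expensive ones:
  lowering a weight raises the cost, and a heavy flow around a cycle would be cheap. So cycles are
  cancelled only when \<alpha> \<ge> 0, and every construction on paths has to preserve acyclicity.
  Translating an atom of mass m by v costs |v| times \<open>m powr \<alpha>\<close>, and the sum of
  these powers over all atoms can be unbounded along the sequence. Hence the translation vector is
  chosen anew for each member of the sequence, and two things remain to be checked: the translated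
  sequence is still Cauchy, and it keeps its weak limit.\<close>

definition net_flow :: "('v \<times> 'v) set \<Rightarrow> ('v \<times> 'v \<Rightarrow> real) \<Rightarrow> 'v \<Rightarrow> real" where
  "net_flow E w v = (\<Sum>e\<in>{e \<in> E. fst e = v}. w e) - (\<Sum>e\<in>{e \<in> E. snd e = v}. w e)"

lemma balanced_iff_net_flow:
  "balanced G s t \<longleftrightarrow> (\<forall>v\<in>verts G. net_flow (edges G) (weight G) v = s v - t v)"
  unfolding balanced_def net_flow_def by (intro ball_cong refl) linarith

lemma net_flow_add:
  "net_flow E (\<lambda>e. w e + w' e) v = net_flow E w v + net_flow E w' v"
  by (simp add: net_flow_def sum.distrib)

lemma net_flow_scale:
  "net_flow E (\<lambda>e. c * w e) v = c * net_flow E w v"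
  by (simp add: net_flow_def sum_distrib_left right_diff_distrib)

lemma net_flow_cong:
  assumes "\<And>e. e \<in> E \<Longrightarrow> w e = w' e"
  shows "net_flow E w v = net_flow E w' v"
  unfolding net_flow_def
  by (intro arg_cong2[where f = "(-)"] sum.cong) (auto simp: assms)

lemma net_flow_mono_neutral:
  assumes "finite E" "E' \<subseteq> E" "\<And>e. e \<in> E - E' \<Longrightarrow> w e = 0"
  shows "net_flow E' w v = net_flow E w v"
  unfolding net_flow_def
  by (intro arg_cong2[where f = "(-)"] sum.mono_neutral_left) (use assms in auto)

lemma net_flow_union:
  assumes "finite E" "finite E'" "E \<inter> E' = {}"
  shows "net_flow (E \<union> E') w v = net_flow E w v + net_flow E' w v"
proof -
  have *: "(\<Sum>e\<in>{e \<in> E \<union> E'. P e}. w e) = (\<Sum>e\<in>{e \<in> E. P e}. w e) + (\<Sum>e\<in>{e \<in> E'. P e}. w e)"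
    for P
  proof -
    have "{e \<in> E \<union> E'. P e} = {e \<in> E. P e} \<union> {e \<in> E'. P e}" by auto
    then show ?thesis
      using assms by (simp only:) (intro sum.union_disjoint, auto)
  qed
  show ?thesis unfolding net_flow_def * by simp
qed

lemma net_flow_single:
  assumes "finite E" "e0 \<in> E"
  shows "net_flow E (\<lambda>e. of_bool (e = e0)) v = of_bool (v = fst e0) - of_bool (v = snd e0)"
proof -
  have "(\<Sum>e\<in>{e \<in> E. P e}. of_bool (e = e0)) = (of_bool (P e0) :: real)" for P
    using assms by (simp add: of_bool_def sum.delta)
  then show ?thesis by (auto simp: net_flow_def)
qed

lemma net_flow_outside:
  assumes "E \<subseteq> V \<times> V" "v \<notin> V"
  shows "net_flow E w v = 0"
proof -
  have "{e \<in> E. fst e = v} = {}" "{e \<in> E. snd e = v} = {}" using assms by auto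
  then show ?thesis by (simp only: net_flow_def sum.empty diff_0_right)
qed

text \<open>Counting how often a walk uses each edge gives a unit flow from its start to its end.
  For \<open>x = y\<close> this is a nonzero circulation; multiplicities make it unnecessary to
  extract a simple cycle.\<close>

lemma trancl_imp_unit_flow:
  assumes "(x, y) \<in> E\<^sup>+" "finite E"
  shows "\<exists>c. (\<forall>e. 0 \<le> c e) \<and> (\<exists>e\<in>E. 0 < c e) \<and>
    (\<forall>v. net_flow E c v = of_bool (v = x) - of_bool (v = y))"
  using assms(1)
proof (induction rule: trancl_induct)
  case (base y)
  then show ?case
    by (intro exI[of _ "\<lambda>e. of_bool (e = (x, y))"]) (auto simp: net_flow_single[OF assms(2)])
next
  case (step y z)
  then obtain c e0 where c: "\<forall>e. 0 \<le> c e" and e0: "e0 \<in> E" "0 < c e0"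
    and flow: "\<And>v. net_flow E c v = of_bool (v = x) - of_bool (v = y)" by blast
  define c' where "c' = (\<lambda>e. c e + of_bool (e = (y, z)))"
  have "net_flow E c' v = of_bool (v = x) - of_bool (v = z)" for v
    by (simp add: c'_def net_flow_add net_flow_single[OF assms(2) step.hyps(2)] flow)
  moreover have "0 < c' e0" using e0 c by (auto simp: c'_def add_pos_nonneg)
  moreover have "\<forall>e. 0 \<le> c' e" using c by (simp add: c'_def)
  ultimately show ?case using e0(1) by blast
qed

text \<open>Cycle cancelling: subtracting a multiple of a circulation leaves the net flow unchanged,
  and the right multiple empties at least one edge, so induction on the edge set applies. The bound
  \<open>w' e \<le> w e\<close> is kept for the comparison of costs.\<close>

lemma acyclic_subflow:
  fixes w :: "'v \<times> 'v \<Rightarrow> real"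
  assumes "finite E" "\<And>e. e \<in> E \<Longrightarrow> 0 < w e"
  shows "\<exists>E' w'. E' \<subseteq> E \<and> acyclic E' \<and> (\<forall>e\<in>E'. 0 < w' e \<and> w' e \<le> w e) \<and>
    (\<forall>v. net_flow E' w' v = net_flow E w v)"
  using assms
proof (induction E arbitrary: w rule: finite_psubset_induct)
  case (psubset E)
  show ?case
  proof (cases "acyclic E")
    case True
    then show ?thesis
      using psubset.prems by (intro exI[of _ E] exI[of _ w]) auto
  next
    case False
    then obtain x where "(x, x) \<in> E\<^sup>+" by (auto simp: acyclic_def)
    from trancl_imp_unit_flow[OF this psubset.hyps] obtain c where
      c: "\<And>e. 0 \<le> c e" and c_pos: "\<exists>e\<in>E. 0 < c e" and c_flow: "\<And>v. net_flow E c v = 0"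
      by auto
    define P where "P = {e \<in> E. 0 < c e}"
    \<comment> \<open>The largest multiple of \<open>c\<close> that can be subtracted without a
      negative weight; an edge attaining the minimum ends with weight 0.\<close>
    define t where "t = Min ((\<lambda>e. w e / c e) ` P)"
    have P: "finite P" "P \<noteq> {}" using psubset.hyps c_pos by (auto simp: P_def)
    define w1 where "w1 = (\<lambda>e. w e + (- t) * c e)"
    have t_le: "t \<le> w e / c e" if "e \<in> P" for e
      unfolding t_def using P that by (intro Min_le) auto
    have "t \<in> (\<lambda>e. w e / c e) ` P"
      unfolding t_def using P by (intro Min_in) auto
    then obtain e0 where e0: "e0 \<in> P" "t = w e0 / c e0" by auto
    have t_pos: "0 < t" using e0 psubset.prems by (auto simp: P_def)
    have w1_nonneg: "0 \<le> w1 e" if "e \<in> E" for e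
    proof (cases "e \<in> P")
      case True
      then show ?thesis using t_le[OF True] by (simp add: w1_def P_def field_simps)
    next
      case False
      then have "c e = 0" using that c[of e] by (auto simp: P_def)
      then show ?thesis using psubset.prems[OF that] by (simp add: w1_def)
    qed
    have w1_le: "w1 e \<le> w e" for e
      using t_pos c[of e] by (simp add: w1_def)
    \<comment> \<open>Emptied edges are discarded because weights must be positive; they contribute
      nothing to the net flow.\<close>
    define E1 where "E1 = {e \<in> E. 0 < w1 e}"
    have "w1 e0 = 0" using e0 by (auto simp: w1_def P_def)
    then have "e0 \<notin> E1" by (simp add: E1_def)
    with e0 have "E1 \<subset> E" by (auto simp: E1_def P_def)
    from psubset.IH[OF this, of w1] obtain E' w' where
      E': "E' \<subseteq> E1" "acyclic E'" "\<forall>e\<in>E'. 0 < w' e \<and> w' e \<le> w1 e"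
        "\<forall>v. net_flow E' w' v = net_flow E1 w1 v"
      by (auto simp: E1_def)
    have "net_flow E1 w1 v = net_flow E w v" for v
    proof -
      have "net_flow E1 w1 v = net_flow E w1 v"
        using psubset.hyps w1_nonneg by (intro net_flow_mono_neutral) (auto simp: E1_def not_less intro: antisym)
      also have "\<dots> = net_flow E w v"
        unfolding w1_def net_flow_add net_flow_scale c_flow by simp
      finally show ?thesis .
    qed
    moreover have "w' e \<le> w e" if "e \<in> E'" for e
      using E'(3) that w1_le[of e] by (auto intro: order_trans)
    ultimately show ?thesis
      using E' \<open>E1 \<subset> E\<close> by (intro exI[of _ E'] exI[of _ w']) auto
  qed
qed

text \<open>A cut argument. Let \<open>R\<close> be the set of vertices reachable from the head of
  \<open>e\<close>. No edge leaves \<open>R\<close>, and by acyclicity the tail of \<open>e\<close>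
  is outside \<open>R\<close>. So the flow into vertices of \<open>R\<close> exceeds the flow out of
  them by at least the weight of \<open>e\<close>, and only sinks in \<open>R\<close> can absorb
  this excess.\<close>

lemma weight_le_total_sink:
  assumes G: "wdigraph G" and ac: "acyclic (edges G)" and bal: "balanced G s t"
    and nonneg: "\<And>v. 0 \<le> s v" "\<And>v. 0 \<le> t v" and e: "e \<in> edges G"
  shows "weight G e \<le> (\<Sum>v\<in>verts G. t v)"
proof -
  have fin: "finite (verts G)" and E: "edges G \<subseteq> verts G \<times> verts G"
    and w: "\<And>e. e \<in> edges G \<Longrightarrow> 0 < weight G e"
    using G by (auto simp: wdigraph_def)
  then have finE: "finite (edges G)" using finite_subset by blast
  obtain u y where uy: "e = (u, y)" by force
  define R where "R = {v \<in> verts G. (y, v) \<in> (edges G)\<^sup>*}"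
  have R: "R \<subseteq> verts G" "finite R" using fin by (auto simp: R_def)
  have "u \<notin> R"
    using ac e by (auto simp: R_def uy acyclic_def dest: rtrancl_into_trancl1)
  have "y \<in> R" using e E by (auto simp: R_def uy)
  have fibre: "(\<Sum>v\<in>R. \<Sum>e\<in>{e \<in> edges G. f e = v}. weight G e) = (\<Sum>e\<in>{e \<in> edges G. f e \<in> R}. weight G e)"
    for f
  proof -
    have "(\<Sum>v\<in>R. \<Sum>e\<in>{e \<in> {e \<in> edges G. f e \<in> R}. f e = v}. weight G e)
        = (\<Sum>e\<in>{e \<in> edges G. f e \<in> R}. weight G e)"
      using finE R by (intro sum.group) auto
    moreover have "{e \<in> {e \<in> edges G. f e \<in> R}. f e = v} = {e \<in> edges G. f e = v}" if "v \<in> R" for v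
      using that by auto
    ultimately show ?thesis by simp
  qed
  have "weight G e + (\<Sum>e\<in>{e \<in> edges G. fst e \<in> R}. weight G e)
      = (\<Sum>e\<in>insert e {e \<in> edges G. fst e \<in> R}. weight G e)"
    using finE \<open>u \<notin> R\<close> by (subst sum.insert) (auto simp: uy)
  also have "\<dots> \<le> (\<Sum>e\<in>{e \<in> edges G. snd e \<in> R}. weight G e)"
  proof (intro sum_mono2)
    show "insert e {e \<in> edges G. fst e \<in> R} \<subseteq> {e \<in> edges G. snd e \<in> R}"
      using e \<open>y \<in> R\<close> E by (force simp: uy R_def intro: rtrancl_into_rtrancl)
  qed (use finE w in \<open>auto intro: less_imp_le\<close>)
  finally have "weight G e \<le> - (\<Sum>v\<in>R. net_flow (edges G) (weight G) v)"
    by (simp add: net_flow_def sum_subtractf fibre)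
  also have "\<dots> = (\<Sum>v\<in>R. t v - s v)"
    using bal R unfolding balanced_iff_net_flow
    by (simp add: sum_negf[symmetric] subset_iff)
  also have "\<dots> \<le> (\<Sum>v\<in>R. t v)"
    using nonneg by (intro sum_mono) auto
  also have "\<dots> \<le> (\<Sum>v\<in>verts G. t v)"
    using nonneg R fin by (intro sum_mono2) auto
  finally show ?thesis .
qed

section \<open>Paths on copies of points\<close>

text \<open>After division by the total \<open>W\<close> all terms lie in (0,1], where x is at most
  \<open>x powr \<alpha>\<close> for \<alpha> \<le> 1, and the normalised terms sum to 1. The
  argument includes negative \<alpha>.\<close>

lemma powr_sum_le:
  fixes f :: "'i \<Rightarrow> real"
  assumes "finite I" "\<And>i. i \<in> I \<Longrightarrow> 0 < f i" "\<alpha> \<le> 1"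
  shows "(\<Sum>i\<in>I. f i) powr \<alpha> \<le> (\<Sum>i\<in>I. f i powr \<alpha>)"
proof (cases "I = {}")
  case False
  define W where "W = (\<Sum>i\<in>I. f i)"
  have W: "0 < W" unfolding W_def using assms False by (intro sum_pos) auto
  have "f i \<le> W" if "i \<in> I" for i
    unfolding W_def using assms that by (intro member_le_sum) (auto intro: less_imp_le)
  then have "f i / W \<le> (f i / W) powr \<alpha>" if "i \<in> I" for i
    using powr_mono'[of \<alpha> 1 "f i / W"] assms that W by (simp add: less_imp_le)
  then have "W powr \<alpha> * (\<Sum>i\<in>I. f i / W) \<le> W powr \<alpha> * (\<Sum>i\<in>I. (f i / W) powr \<alpha>)"
    by (intro mult_left_mono sum_mono) auto
  moreover have "(\<Sum>i\<in>I. f i / W) = 1"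
    using W by (simp add: W_def sum_divide_distrib[symmetric])
  moreover have "W powr \<alpha> * (f i / W) powr \<alpha> = f i powr \<alpha>" if "i \<in> I" for i
    using W assms that by (simp add: powr_mult[symmetric] less_imp_le)
  ultimately show ?thesis
    by (simp add: sum_distrib_left flip: W_def)
qed simp

lemma acyclic_map:
  assumes "acyclic E'" "\<And>x y. (x, y) \<in> E \<Longrightarrow> (f x, f y) \<in> E'"
  shows "acyclic E"
proof -
  have "(f x, f y) \<in> E'\<^sup>+" if "(x, y) \<in> E\<^sup>+" for x y
    using that by (induction rule: trancl_induct) (auto intro: assms(2) trancl_into_trancl)
  then show ?thesis using assms(1) by (auto simp: acyclic_def)
qed

lemma finite_edges: "wdigraph G \<Longrightarrow> finite (edges G)"
  unfolding wdigraph_def using finite_subset by blast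

lemma sum_preimage_supp: "(\<Sum>x | x = v \<and> x \<in> supp a. a x) = a v"
proof -
  have "{x. x = v \<and> x \<in> supp a} = (if a v = 0 then {} else {v})" by (auto simp: supp_def)
  then show ?thesis by simp
qed

lemma copy_pathI:
  assumes "wdigraph G" "\<And>u v. (u, v) \<in> edges G \<Longrightarrow> fst u \<noteq> fst v" "acyclic (edges G)"
    and "\<And>x. x \<in> supp a \<Longrightarrow> s x \<in> verts G \<and> fst (s x) = x"
    and "\<And>y. y \<in> supp b \<Longrightarrow> t y \<in> verts G \<and> fst (t y) = y"
    and "balanced G (\<lambda>v. \<Sum>x\<in>{x \<in> supp a. s x = v}. a x) (\<lambda>v. \<Sum>y\<in>{y \<in> supp b. t y = v}. b y)"
  shows "G \<in> copy_transport_paths a b"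
  using assms unfolding copy_transport_paths_def by blast

text \<open>Cycles are cancelled first, then each point is used with the single copy number 0. The
  assumption \<open>0 \<le> \<alpha>\<close> enters in the cost: only then do smaller weights give
  smaller powers.\<close>

lemma transport_path_imp_copy_path:
  assumes G: "G \<in> transport_paths a b" and fin: "finite (supp a)" "finite (supp b)" and "0 \<le> \<alpha>"
  shows "\<exists>G'\<in>copy_transport_paths a b. M_cost \<alpha> fst G' \<le> M_cost \<alpha> (\<lambda>v. v) G"
proof -
  have wd: "wdigraph G" and sub: "supp a \<subseteq> verts G" "supp b \<subseteq> verts G" and bal: "balanced G a b"
    using G by (auto simp: transport_paths_def)
  have finE: "finite (edges G)" using wd by (rule finite_edges)
  obtain E' w' where E': "E' \<subseteq> edges G" and ac: "acyclic E'"
    and w': "\<And>e. e \<in> E' \<Longrightarrow> 0 < w' e \<and> w' e \<le> weight G e"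
    and flow: "\<And>v. net_flow E' w' v = net_flow (edges G) (weight G) v"
    using acyclic_subflow[OF finE, of "weight G"] wd unfolding wdigraph_def by blast
  define i :: "'a \<times> 'a \<Rightarrow> ('a \<times> nat) \<times> ('a \<times> nat)" where "i = (\<lambda>e. ((fst e, 0), (snd e, 0)))"
  define r :: "('a \<times> nat) \<times> ('a \<times> nat) \<Rightarrow> 'a \<times> 'a" where "r = (\<lambda>e. (fst (fst e), fst (snd e)))"
  have inj: "inj_on i A" for A by (auto simp: inj_on_def i_def)
  have [simp]: "r (i e) = e" for e by (simp add: r_def i_def)
  define G' where "G' = \<lparr>verts = (\<lambda>v. (v, 0)) ` verts G, edges = i ` E', weight = w' \<circ> r\<rparr>"
  have wd': "wdigraph G'"
    unfolding wdigraph_def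
  proof (intro conjI ballI subsetI)
    show "finite (verts G')" using wd by (simp add: wdigraph_def G'_def)
    show "e \<in> verts G' \<times> verts G'" if "e \<in> edges G'" for e
      using that E' wd by (auto simp: wdigraph_def G'_def i_def)
    show "0 < weight G' e" if "e \<in> edges G'" for e
      using that w' by (auto simp: G'_def)
  qed
  \<comment> \<open>With one copy per point, an edge between equal positions would be a loop, which
    acyclicity excludes.\<close>
  have pos': "fst u \<noteq> fst v" if "(u, v) \<in> edges G'" for u v
    using that ac by (auto simp: G'_def i_def acyclic_def dest: r_into_trancl')
  have ac': "acyclic (edges G')"
    using ac by (rule acyclic_map[where f = fst]) (auto simp: G'_def i_def)
  have bal': "balanced G' (\<lambda>v. \<Sum>x\<in>{x \<in> supp a. (x, 0) = v}. a x)
      (\<lambda>v. \<Sum>x\<in>{x \<in> supp b. (x, 0) = v}. b x)"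
    unfolding balanced_iff_net_flow
  proof
    fix v' assume "v' \<in> verts G'"
    then obtain v where v: "v \<in> verts G" "v' = (v, 0)" by (auto simp: G'_def)
    have sum_i: "(\<Sum>e\<in>{e \<in> i ` E'. h e = v'}. (w' \<circ> r) e) = (\<Sum>e\<in>{e \<in> E'. h (i e) = v'}. w' e)" for h
    proof -
      have "{e \<in> i ` E'. h e = v'} = i ` {e \<in> E'. h (i e) = v'}" by blast
      then show ?thesis by (simp add: sum.reindex[OF inj])
    qed
    have "net_flow (edges G') (weight G') v'
        = (\<Sum>e\<in>{e \<in> E'. fst (i e) = v'}. w' e) - (\<Sum>e\<in>{e \<in> E'. snd (i e) = v'}. w' e)"
      by (simp only: net_flow_def G'_def wdigraph.select_convs sum_i)
    also have "\<dots> = net_flow E' w' v" by (simp add: net_flow_def i_def v(2))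
    also have "\<dots> = net_flow (edges G) (weight G) v" by (rule flow)
    also have "\<dots> = a v - b v" using bal v(1) by (simp add: balanced_iff_net_flow)
    finally show "net_flow (edges G') (weight G') v' =
        (\<Sum>x\<in>{x \<in> supp a. (x, 0) = v'}. a x) - (\<Sum>x\<in>{x \<in> supp b. (x, 0) = v'}. b x)"
      using v by (simp add: sum_preimage_supp)
  qed
  have "G' \<in> copy_transport_paths a b"
    using sub by (intro copy_pathI[OF wd' pos' ac' _ _ bal']) (auto simp: G'_def)
  moreover have "M_cost \<alpha> fst G' \<le> M_cost \<alpha> (\<lambda>v. v) G"
  proof -
    have "M_cost \<alpha> fst G' = (\<Sum>e\<in>E'. w' e powr \<alpha> * dist (fst e) (snd e))"
      by (simp add: M_cost_def G'_def sum.reindex[OF inj]) (simp add: i_def)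
    also have "\<dots> \<le> (\<Sum>e\<in>E'. weight G e powr \<alpha> * dist (fst e) (snd e))"
      using w' \<open>0 \<le> \<alpha>\<close> by (intro sum_mono mult_right_mono powr_mono2) (auto intro: less_imp_le)
    also have "\<dots> \<le> M_cost \<alpha> (\<lambda>v. v) G"
      unfolding M_cost_def using finE E' by (intro sum_mono2) auto
    finally show ?thesis .
  qed
  ultimately show ?thesis by blast
qed

text \<open>All copies of a point are identified and the weights of edges that become parallel are
  added; by \<open>powr_sum_le\<close> this does not raise the cost. The balance at a point is the
  sum of the balances at its copies.\<close>

lemma copy_path_imp_transport_path:
  assumes G: "G \<in> copy_transport_paths a b" and fin: "finite (supp a)" "finite (supp b)"
    and "\<alpha> \<le> 1"
  shows "\<exists>G'\<in>transport_paths a b. M_cost \<alpha> (\<lambda>v. v) G' \<le> M_cost \<alpha> fst G"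
proof -
  obtain s t where wd: "wdigraph G"
    and s: "\<And>x. x \<in> supp a \<Longrightarrow> s x \<in> verts G \<and> fst (s x) = x"
    and t: "\<And>x. x \<in> supp b \<Longrightarrow> t x \<in> verts G \<and> fst (t x) = x"
    and bal: "balanced G (\<lambda>v. \<Sum>x\<in>{x \<in> supp a. s x = v}. a x) (\<lambda>v. \<Sum>y\<in>{y \<in> supp b. t y = v}. b y)"
    using G unfolding copy_transport_paths_def by blast
  have finE: "finite (edges G)" using wd by (rule finite_edges)
  have finV: "finite (verts G)" using wd by (simp add: wdigraph_def)
  define r where "r = (\<lambda>e :: ('a \<times> nat) \<times> ('a \<times> nat). (fst (fst e), fst (snd e)))"
  define W where "W = (\<lambda>e'. \<Sum>e\<in>{e \<in> edges G. r e = e'}. weight G e)"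
  define G' where "G' = \<lparr>verts = fst ` verts G, edges = r ` edges G, weight = W\<rparr>"
  have W_pos: "0 < W e'" if "e' \<in> r ` edges G" for e'
    unfolding W_def using that finE wd by (intro sum_pos) (auto simp: wdigraph_def)
  have "wdigraph G'"
    unfolding wdigraph_def
  proof (intro conjI ballI subsetI)
    show "finite (verts G')" using wd by (simp add: wdigraph_def G'_def)
    show "e \<in> verts G' \<times> verts G'" if "e \<in> edges G'" for e
      using that wd unfolding wdigraph_def G'_def r_def
      by (auto dest!: subsetD intro: image_eqI[where f = fst])
    show "0 < weight G' e" if "e \<in> edges G'" for e
      using that W_pos by (auto simp: G'_def)
  qed
  moreover have "supp a \<subseteq> verts G'" "supp b \<subseteq> verts G'"
    using s t by (force simp: G'_def image_iff)+
  moreover have "balanced G' a b"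
    unfolding balanced_iff_net_flow
  proof
    fix x assume "x \<in> verts G'"
    \<comment> \<open>Both sides sum the weights of the edges with the chosen endpoint
      (\<open>g\<close> is \<open>fst\<close> or \<open>snd\<close>) over \<open>x\<close>, grouped
      on the left by merged edge and on the right by the copy at which they end.\<close>
    have merge: "(\<Sum>e'\<in>{e' \<in> r ` edges G. h e' = x}. W e')
        = (\<Sum>v\<in>{v \<in> verts G. fst v = x}. \<Sum>e\<in>{e \<in> edges G. g e = v}. weight G e)"
      if h: "\<And>e. h (r e) = fst (g e)" and g: "\<And>e. e \<in> edges G \<Longrightarrow> g e \<in> verts G" for h g
    proof -
      let ?F = "{e \<in> edges G. h (r e) = x}"
      have "(\<Sum>e'\<in>{e' \<in> r ` edges G. h e' = x}. \<Sum>e\<in>{e \<in> ?F. r e = e'}. weight G e)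
          = (\<Sum>e\<in>?F. weight G e)"
        using finE by (intro sum.group) auto
      moreover have "(\<Sum>v\<in>{v \<in> verts G. fst v = x}. \<Sum>e\<in>{e \<in> ?F. g e = v}. weight G e)
          = (\<Sum>e\<in>?F. weight G e)"
        using finE finV h g by (intro sum.group) auto
      moreover have "{e \<in> ?F. r e = e'} = {e \<in> edges G. r e = e'}" if "h e' = x" for e'
        using that by auto
      moreover have "{e \<in> ?F. g e = v} = {e \<in> edges G. g e = v}" if "fst v = x" for v
        using that h by auto
      ultimately show ?thesis by (simp add: W_def)
    qed
    \<comment> \<open>An atom is assigned to a vertex at its own position, so among the copies of
      \<open>x\<close> only the atom at \<open>x\<close> is counted, and exactly once.\<close>
    have merge_end: "(\<Sum>v\<in>{v \<in> verts G. fst v = x}. \<Sum>y\<in>{y \<in> supp c. q y = v}. c y) = c x"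
      if fc: "finite (supp c)" and q: "\<And>y. y \<in> supp c \<Longrightarrow> q y \<in> verts G \<and> fst (q y) = y" for c q
    proof -
      have "{y \<in> supp c. q y = v} = {y \<in> {y \<in> supp c. y = x}. q y = v}" if "fst v = x" for v
        using that q by auto
      then have "(\<Sum>v\<in>{v \<in> verts G. fst v = x}. \<Sum>y\<in>{y \<in> supp c. q y = v}. c y)
        = (\<Sum>v\<in>{v \<in> verts G. fst v = x}. \<Sum>y\<in>{y \<in> {y \<in> supp c. y = x}. q y = v}. c y)"
        by simp
      also have "\<dots> = (\<Sum>y\<in>{y \<in> supp c. y = x}. c y)"
        using finV fc q by (intro sum.group) auto
      finally show ?thesis by (simp add: sum_preimage_supp)
    qed
    have ends: "fst e \<in> verts G" "snd e \<in> verts G" if "e \<in> edges G" for e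
      using that wd by (auto simp: wdigraph_def)
    have "net_flow (edges G') (weight G') x
        = (\<Sum>v\<in>{v \<in> verts G. fst v = x}. net_flow (edges G) (weight G) v)"
      unfolding net_flow_def G'_def sum_subtractf wdigraph.select_convs
      by (intro arg_cong2[where f = "(-)"] merge) (auto simp: r_def ends)
    also have "\<dots> = (\<Sum>v\<in>{v \<in> verts G. fst v = x}. (\<Sum>x\<in>{x \<in> supp a. s x = v}. a x)
        - (\<Sum>y\<in>{y \<in> supp b. t y = v}. b y))"
      using bal by (simp add: balanced_iff_net_flow)
    also have "\<dots> = a x - b x"
      unfolding sum_subtractf using fin s t by (simp add: merge_end)
    finally show "net_flow (edges G') (weight G') x = a x - b x" .
  qed
  ultimately have "G' \<in> transport_paths a b" by (simp add: transport_paths_def)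
  moreover have "M_cost \<alpha> (\<lambda>v. v) G' \<le> M_cost \<alpha> fst G"
  proof -
    let ?d = "\<lambda>e :: 'a \<times> 'a. dist (fst e) (snd e)"
    have "M_cost \<alpha> (\<lambda>v. v) G' = (\<Sum>e'\<in>r ` edges G. W e' powr \<alpha> * ?d e')"
      by (simp add: M_cost_def G'_def)
    also have "\<dots> \<le> (\<Sum>e'\<in>r ` edges G. (\<Sum>e\<in>{e \<in> edges G. r e = e'}. weight G e powr \<alpha>) * ?d e')"
      unfolding W_def using finE wd \<open>\<alpha> \<le> 1\<close>
      by (intro sum_mono mult_right_mono powr_sum_le) (auto simp: wdigraph_def)
    also have "\<dots> = (\<Sum>e'\<in>r ` edges G. \<Sum>e\<in>{e \<in> edges G. r e = e'}. weight G e powr \<alpha> * ?d (r e))"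
      by (simp add: sum_distrib_right)
    also have "\<dots> = (\<Sum>e\<in>edges G. weight G e powr \<alpha> * ?d (r e))"
      using finE by (intro sum.group) auto
    also have "\<dots> = M_cost \<alpha> fst G" by (simp add: M_cost_def r_def)
    finally show ?thesis .
  qed
  ultimately show ?thesis by blast
qed

section \<open>Scaling, reversing and translating paths\<close>

lemma copy_pathE:
  assumes "G \<in> copy_transport_paths a b"
  obtains s t where "wdigraph G" "\<And>u v. (u, v) \<in> edges G \<Longrightarrow> fst u \<noteq> fst v" "acyclic (edges G)"
    and "\<And>x. x \<in> supp a \<Longrightarrow> s x \<in> verts G \<and> fst (s x) = x"
    and "\<And>y. y \<in> supp b \<Longrightarrow> t y \<in> verts G \<and> fst (t y) = y"
    and "balanced G (\<lambda>v. \<Sum>x\<in>{x \<in> supp a. s x = v}. a x) (\<lambda>v. \<Sum>y\<in>{y \<in> supp b. t y = v}. b y)"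
  using assms unfolding copy_transport_paths_def by blast

lemma copy_path_weight_le_mass:
  assumes G: "G \<in> copy_transport_paths a b" and a: "atomic a" and b: "atomic b"
    and e: "e \<in> edges G"
  shows "weight G e \<le> mass b"
proof -
  from G obtain s t where wd: "wdigraph G" and ac: "acyclic (edges G)"
    and t: "\<And>y. y \<in> supp b \<Longrightarrow> t y \<in> verts G \<and> fst (t y) = y"
    and bal: "balanced G (\<lambda>v. \<Sum>x\<in>{x \<in> supp a. s x = v}. a x) (\<lambda>v. \<Sum>y\<in>{y \<in> supp b. t y = v}. b y)"
    by (rule copy_pathE) (rule that)
  have "weight G e \<le> (\<Sum>v\<in>verts G. \<Sum>y\<in>{y \<in> supp b. t y = v}. b y)"
    using a b by (intro weight_le_total_sink[OF wd ac bal _ _ e] sum_nonneg) (auto simp: atomic_def)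
  also have "\<dots> = mass b"
    unfolding mass_def using wd b t by (intro sum.group) (auto simp: wdigraph_def atomic_def)
  finally show ?thesis .
qed

lemma copy_path_M_cost_antimono:
  assumes G: "G \<in> copy_transport_paths a b" and "atomic a" "atomic b" "mass b \<le> 1" "\<alpha> \<le> \<beta>"
  shows "M_cost \<beta> fst G \<le> M_cost \<alpha> fst G"
  unfolding M_cost_def
proof (intro sum_mono mult_right_mono)
  fix e assume e: "e \<in> edges G"
  have "weight G e \<le> 1"
    using copy_path_weight_le_mass[OF assms(1-3) e] assms(4) by linarith
  moreover have "0 < weight G e"
    using G e by (auto elim!: copy_pathE simp: wdigraph_def)
  ultimately show "weight G e powr \<beta> \<le> weight G e powr \<alpha>"
    using assms(5) by (intro powr_mono') auto
qed auto

lemma supp_scale: "c \<noteq> 0 \<Longrightarrow> supp (\<lambda>y. c * b y) = supp b"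
  by (auto simp: supp_def)

lemma copy_path_scale:
  assumes G: "G \<in> copy_transport_paths a b" and c: "0 < c"
  shows "\<exists>G'\<in>copy_transport_paths (\<lambda>y. c * a y) (\<lambda>y. c * b y).
    M_cost \<alpha> fst G' = c powr \<alpha> * M_cost \<alpha> fst G"
proof -
  from G obtain s t where wd: "wdigraph G" and pos: "\<And>u v. (u, v) \<in> edges G \<Longrightarrow> fst u \<noteq> fst v"
    and ac: "acyclic (edges G)"
    and s: "\<And>x. x \<in> supp a \<Longrightarrow> s x \<in> verts G \<and> fst (s x) = x"
    and t: "\<And>y. y \<in> supp b \<Longrightarrow> t y \<in> verts G \<and> fst (t y) = y"
    and bal: "balanced G (\<lambda>v. \<Sum>x\<in>{x \<in> supp a. s x = v}. a x) (\<lambda>v. \<Sum>y\<in>{y \<in> supp b. t y = v}. b y)"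
    by (rule copy_pathE) (rule that)
  define G' where "G' = G\<lparr>weight := \<lambda>e. c * weight G e\<rparr>"
  have wd': "wdigraph G'" using wd c by (simp add: wdigraph_def G'_def)
  have bal': "balanced G' (\<lambda>v. \<Sum>x\<in>{x \<in> supp (\<lambda>y. c * a y). s x = v}. c * a x)
      (\<lambda>v. \<Sum>y\<in>{y \<in> supp (\<lambda>y. c * b y). t y = v}. c * b y)"
    using bal c unfolding balanced_iff_net_flow
    by (simp add: G'_def net_flow_scale supp_scale flip: sum_distrib_left right_diff_distrib)
  have "G' \<in> copy_transport_paths (\<lambda>y. c * a y) (\<lambda>y. c * b y)"
    using pos ac s t c by (intro copy_pathI[OF wd' _ _ _ _ bal']) (auto simp: G'_def supp_scale)
  moreover have "M_cost \<alpha> fst G' = c powr \<alpha> * M_cost \<alpha> fst G"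
    using wd c unfolding M_cost_def sum_distrib_left
    by (intro sum.cong) (auto simp: G'_def powr_mult wdigraph_def less_imp_le)
  ultimately show ?thesis by blast
qed

lemma copy_path_reverse:
  assumes G: "G \<in> copy_transport_paths a b"
  shows "\<exists>G'\<in>copy_transport_paths b a. M_cost \<alpha> fst G' = M_cost \<alpha> fst G"
proof -
  from G obtain s t where wd: "wdigraph G" and pos: "\<And>u v. (u, v) \<in> edges G \<Longrightarrow> fst u \<noteq> fst v"
    and ac: "acyclic (edges G)"
    and s: "\<And>x. x \<in> supp a \<Longrightarrow> s x \<in> verts G \<and> fst (s x) = x"
    and t: "\<And>y. y \<in> supp b \<Longrightarrow> t y \<in> verts G \<and> fst (t y) = y"
    and bal: "balanced G (\<lambda>v. \<Sum>x\<in>{x \<in> supp a. s x = v}. a x) (\<lambda>v. \<Sum>y\<in>{y \<in> supp b. t y = v}. b y)"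
    by (rule copy_pathE) (rule that)
  define G' where "G' = G\<lparr>edges := (edges G)\<inverse>, weight := weight G \<circ> prod.swap\<rparr>"
  have conv: "(edges G)\<inverse> = prod.swap ` edges G" by auto
  have inj: "inj_on prod.swap A" for A :: "(('a \<times> nat) \<times> ('a \<times> nat)) set" by simp
  have swap_sum: "(\<Sum>e\<in>{e \<in> prod.swap ` E. h e = v}. (weight G \<circ> prod.swap) e)
      = (\<Sum>e\<in>{e \<in> E. h (prod.swap e) = v}. weight G e)" for E h v
  proof -
    have "{e \<in> prod.swap ` E. h e = v} = prod.swap ` {e \<in> E. h (prod.swap e) = v}" by blast
    then show ?thesis by (simp add: sum.reindex[OF inj])
  qed
  have sel: "edges G' = prod.swap ` edges G" "weight G' = weight G \<circ> prod.swap"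
    by (simp_all add: G'_def conv)
  have flow: "net_flow (edges G') (weight G') v = - net_flow (edges G) (weight G) v" for v
    unfolding net_flow_def sel swap_sum by simp
  have wd': "wdigraph G'" using wd by (auto simp: wdigraph_def G'_def)
  have bal': "balanced G' (\<lambda>v. \<Sum>y\<in>{y \<in> supp b. t y = v}. b y)
      (\<lambda>v. \<Sum>x\<in>{x \<in> supp a. s x = v}. a x)"
    using bal unfolding balanced_iff_net_flow flow by (simp add: G'_def)
  have pos': "fst u \<noteq> fst v" if "(u, v) \<in> edges G'" for u v
    using that pos[of v u] by (auto simp: G'_def)
  have "G' \<in> copy_transport_paths b a"
    using ac s t by (intro copy_pathI[OF wd' pos' _ _ _ bal']) (auto simp: G'_def)
  moreover have "M_cost \<alpha> fst G' = M_cost \<alpha> fst G"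
    by (simp add: M_cost_def G'_def conv sum.reindex[OF inj] dist_commute)
  ultimately show ?thesis by blast
qed

text \<open>Heads of \<open>F\<close>-edges have no outgoing edge, so a walk stays in
  \<open>E\<close> until it takes an edge of \<open>F\<close>, and there it stops. A closed walk
  therefore lies entirely in \<open>E\<close>.\<close>

lemma acyclic_Un_sinks:
  assumes "acyclic E" and F: "Range F \<inter> Domain (E \<union> F) = {}"
  shows "acyclic (E \<union> F)"
  unfolding acyclic_def
proof (intro allI notI)
  fix x assume x: "(x, x) \<in> (E \<union> F)\<^sup>+"
  have "(x, y) \<in> E\<^sup>+ \<or> y \<in> Range F" if "(x, y) \<in> (E \<union> F)\<^sup>+" for y
    using that
  proof (induction rule: trancl_induct)
    case (base y)
    then show ?case by auto
  next
    case (step y z)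
    then show ?case using F by (auto intro: trancl_into_trancl)
  qed
  from this[OF x] have "x \<in> Range F" using assms(1) by (auto simp: acyclic_def)
  moreover have "x \<in> Domain (E \<union> F)" using x by (metis Domain.DomainI tranclD)
  ultimately show False using F by blast
qed

lemma supp_shift:
  fixes v :: "'a::real_normed_vector"
  shows "supp (\<lambda>z. b (z - v)) = (\<lambda>y. y + v) ` supp b"
proof -
  have "z \<in> (\<lambda>y. y + v) ` supp b" if "b (z - v) \<noteq> 0" for z
    using that by (intro image_eqI[of _ _ "z - v"]) (auto simp: supp_def)
  then show ?thesis by (auto simp: supp_def)
qed

text \<open>Every target atom gets an edge of its own to its translate.\<close>

lemma copy_path_shift_target:
  fixes a b :: "'a::real_normed_vector \<Rightarrow> real"
  assumes G: "G \<in> copy_transport_paths a b" and b: "atomic b" and v: "v \<noteq> 0"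
  shows "\<exists>G'\<in>copy_transport_paths a (\<lambda>z. b (z - v)).
    M_cost \<alpha> fst G' = M_cost \<alpha> fst G + norm v * (\<Sum>y\<in>supp b. b y powr \<alpha>)"
proof -
  from G obtain s t where wd: "wdigraph G" and pos: "\<And>u v. (u, v) \<in> edges G \<Longrightarrow> fst u \<noteq> fst v"
    and ac: "acyclic (edges G)"
    and s: "\<And>x. x \<in> supp a \<Longrightarrow> s x \<in> verts G \<and> fst (s x) = x"
    and t: "\<And>y. y \<in> supp b \<Longrightarrow> t y \<in> verts G \<and> fst (t y) = y"
    and bal: "balanced G (\<lambda>v. \<Sum>x\<in>{x \<in> supp a. s x = v}. a x) (\<lambda>v. \<Sum>y\<in>{y \<in> supp b. t y = v}. b y)"
    by (rule copy_pathE) (rule that)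
  have b_pos: "0 < b y" if "y \<in> supp b" for y
    using b that by (auto simp: atomic_def supp_def order.strict_iff_order)
  have finb: "finite (supp b)" using b by (auto simp: atomic_def)
  have finE: "finite (edges G)" using wd by (rule finite_edges)
  have finV: "finite (verts G)" and EV: "edges G \<subseteq> verts G \<times> verts G"
    using wd by (auto simp: wdigraph_def)
  \<comment> \<open>A fresh copy number: a translated atom may fall on the position of an old
    vertex, but its vertex is new, so old balances are affected only by the added outgoing edges and
    no cycle arises.\<close>
  obtain n where n: "\<And>u. u \<in> verts G \<Longrightarrow> snd u < n"
    using finite_nat_set_iff_bounded[of "snd ` verts G"] finV by auto
  define q where "q = (\<lambda>y. (y + v, n))"
  define f where "f = (\<lambda>y. (t y, q y))"
  define F where "F = f ` supp b"
  \<comment> \<open>An edge of \<open>F\<close> starts at \<open>t y\<close>, which sits at position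
    \<open>y\<close>; its weight \<open>b y\<close> can thus be read off the position of its
    tail.\<close>
  define w where "w = (\<lambda>e. if e \<in> edges G then weight G e else b (fst (fst e)))"
  define G' where "G' = \<lparr>verts = verts G \<union> q ` supp b, edges = edges G \<union> F, weight = w\<rparr>"
  have q_new: "q y \<notin> verts G" for y using n by (force simp: q_def)
  have t_ne_q: "t y \<noteq> q y'" if "y \<in> supp b" for y y' using that t q_new by metis
  have finF: "finite F" using finb by (simp add: F_def)
  have disj: "edges G \<inter> F = {}" using EV q_new by (auto simp: F_def f_def)
  have inj: "inj_on f A" for A by (auto simp: inj_on_def f_def q_def)
  have wF: "w (f y) = b y" if "y \<in> supp b" for y
    using that disj t by (auto simp: w_def F_def f_def)
  have wd': "wdigraph G'"
    unfolding wdigraph_def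
  proof (intro conjI ballI subsetI)
    show "finite (verts G')" using finV finb by (simp add: G'_def)
    show "e \<in> verts G' \<times> verts G'" if "e \<in> edges G'" for e
      using that EV t by (auto simp: G'_def F_def f_def)
    show "0 < weight G' e" if "e \<in> edges G'" for e
      using that wd b_pos wF by (auto simp: G'_def F_def wdigraph_def) (auto simp: w_def)
  qed
  have pos': "fst u \<noteq> fst u'" if "(u, u') \<in> edges G'" for u u'
    using that pos[of u u'] t v by (auto simp: G'_def F_def f_def q_def)
  have ac': "acyclic (edges G')"
    unfolding G'_def wdigraph.select_convs using ac EV q_new t_ne_q
    by (intro acyclic_Un_sinks) (auto simp: F_def f_def)
  have bal': "balanced G' (\<lambda>u. \<Sum>x\<in>{x \<in> supp a. s x = u}. a x)
      (\<lambda>u. \<Sum>y\<in>{y \<in> supp (\<lambda>z. b (z - v)). (y, n) = u}. b (y - v))"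
    unfolding balanced_iff_net_flow
  proof
    fix u assume "u \<in> verts G'"
    \<comment> \<open>The balance equation of \<open>G\<close> extends to the new vertices, where
      both sides vanish.\<close>
    have "net_flow (edges G) (weight G) u
        = (\<Sum>x\<in>{x \<in> supp a. s x = u}. a x) - (\<Sum>y\<in>{y \<in> supp b. t y = u}. b y)"
    proof (cases "u \<in> verts G")
      case True
      then show ?thesis using bal by (simp add: balanced_iff_net_flow)
    next
      case False
      then have "{x \<in> supp a. s x = u} = {}" "{y \<in> supp b. t y = u} = {}" using s t by auto
      then show ?thesis using net_flow_outside[OF EV False] by (simp only: sum.empty)
    qed
    moreover have "net_flow F w u
        = (\<Sum>y\<in>{y \<in> supp b. t y = u}. b y) - (\<Sum>y\<in>{y \<in> supp b. q y = u}. b y)"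
    proof -
      have "(\<Sum>e\<in>{e \<in> F. h e = u}. w e) = (\<Sum>y\<in>{y \<in> supp b. h (f y) = u}. b y)" for h
      proof -
        have "{e \<in> F. h e = u} = f ` {y \<in> supp b. h (f y) = u}" unfolding F_def by blast
        then show ?thesis using wF by (simp add: sum.reindex[OF inj])
      qed
      then show ?thesis by (simp add: net_flow_def f_def)
    qed
    moreover have "(\<Sum>y\<in>{y \<in> supp b. q y = u}. b y)
        = (\<Sum>y\<in>{y \<in> supp (\<lambda>z. b (z - v)). (y, n) = u}. b (y - v))"
      by (rule sum.reindex_bij_witness[of _ "\<lambda>y. y - v" "\<lambda>y. y + v"])
        (auto simp: q_def supp_def)
    moreover have "net_flow (edges G') (weight G') u
        = net_flow (edges G) (weight G) u + net_flow F w u"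
      using net_flow_union[OF finE finF disj, of w u] net_flow_cong[of "edges G" w "weight G" u]
      by (simp add: G'_def w_def)
    ultimately show "net_flow (edges G') (weight G') u = (\<Sum>x\<in>{x \<in> supp a. s x = u}. a x)
        - (\<Sum>y\<in>{y \<in> supp (\<lambda>z. b (z - v)). (y, n) = u}. b (y - v))" by linarith
  qed
  have "G' \<in> copy_transport_paths a (\<lambda>z. b (z - v))"
    using s by (intro copy_pathI[OF wd' pos' ac' _ _ bal']) (auto simp: supp_shift G'_def q_def)
  moreover have "M_cost \<alpha> fst G' = M_cost \<alpha> fst G + norm v * (\<Sum>y\<in>supp b. b y powr \<alpha>)"
  proof -
    let ?d = "\<lambda>e :: ('a \<times> nat) \<times> ('a \<times> nat). dist (fst (fst e)) (fst (snd e))"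
    have "M_cost \<alpha> fst G' = (\<Sum>e\<in>edges G. w e powr \<alpha> * ?d e) + (\<Sum>e\<in>F. w e powr \<alpha> * ?d e)"
      using sum.union_disjoint[OF finE finF disj] by (simp add: M_cost_def G'_def)
    also have "(\<Sum>e\<in>edges G. w e powr \<alpha> * ?d e) = M_cost \<alpha> fst G"
      unfolding M_cost_def by (intro sum.cong) (auto simp: w_def)
    also have "(\<Sum>e\<in>F. w e powr \<alpha> * ?d e) = (\<Sum>y\<in>supp b. b y powr \<alpha> * norm v)"
      unfolding F_def sum.reindex[OF inj] o_def using t
      by (intro sum.cong) (auto simp: wF, auto simp: f_def q_def dist_norm)
    finally show ?thesis by (simp add: sum_distrib_left mult.commute)
  qed
  ultimately show ?thesis by blast
qed

text \<open>The source is the target of the reversed path, so moving it is a reversal, a translation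
  of the target and a second reversal.\<close>

lemma copy_path_shift:
  fixes a b :: "'a::real_normed_vector \<Rightarrow> real"
  assumes "G \<in> copy_transport_paths a b" "atomic a" "atomic b" "u \<noteq> 0" "v \<noteq> 0"
  shows "\<exists>G'\<in>copy_transport_paths (\<lambda>z. a (z - u)) (\<lambda>z. b (z - v)). M_cost \<alpha> fst G'
    = M_cost \<alpha> fst G + norm u * (\<Sum>x\<in>supp a. a x powr \<alpha>) + norm v * (\<Sum>y\<in>supp b. b y powr \<alpha>)"
proof -
  obtain G1 where G1: "G1 \<in> copy_transport_paths b a" "M_cost \<alpha> fst G1 = M_cost \<alpha> fst G"
    using copy_path_reverse[OF assms(1)] by blast
  obtain G2 where G2: "G2 \<in> copy_transport_paths b (\<lambda>z. a (z - u))"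
    "M_cost \<alpha> fst G2 = M_cost \<alpha> fst G1 + norm u * (\<Sum>x\<in>supp a. a x powr \<alpha>)"
    using copy_path_shift_target[OF G1(1) assms(2,4)] by blast
  obtain G3 where G3: "G3 \<in> copy_transport_paths (\<lambda>z. a (z - u)) b" "M_cost \<alpha> fst G3 = M_cost \<alpha> fst G2"
    using copy_path_reverse[OF G2(1)] by blast
  obtain G4 where G4: "G4 \<in> copy_transport_paths (\<lambda>z. a (z - u)) (\<lambda>z. b (z - v))"
    "M_cost \<alpha> fst G4 = M_cost \<alpha> fst G3 + norm v * (\<Sum>y\<in>supp b. b y powr \<alpha>)"
    using copy_path_shift_target[OF G3(1) assms(3,5)] by blast
  show ?thesis using G1(2) G2(2) G3(2) G4 by (intro bexI[of _ G4]) auto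
qed

section \<open>Refinements of atomic measures\<close>

lemma atomic_pos: "atomic a \<Longrightarrow> x \<in> supp a \<Longrightarrow> 0 < a x"
  by (auto simp: atomic_def supp_def order.strict_iff_order)

lemma supp_point_atom: "supp (point_atom m x) = (if m = 0 then {} else {x})"
  by (auto simp: supp_def point_atom_def)

lemma atomic_point_atom: "0 \<le> m \<Longrightarrow> atomic (point_atom m x)"
  by (auto simp: atomic_def supp_point_atom, auto simp: point_atom_def)

lemma mass_point_atom: "mass (point_atom m x) = m"
  by (simp add: mass_def supp_point_atom) (simp add: point_atom_def)

lemma atomic_shift:
  fixes a :: "'a::real_normed_vector \<Rightarrow> real"
  shows "atomic a \<Longrightarrow> atomic (\<lambda>z. a (z - v))"
  by (auto simp: atomic_def supp_shift)

lemma sum_supp_shift: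
  fixes a :: "'a::real_normed_vector \<Rightarrow> real"
  shows "(\<Sum>z\<in>supp (\<lambda>z. a (z - v)). f z) = (\<Sum>y\<in>supp a. f (y + v))"
  unfolding supp_shift by (subst sum.reindex) (auto simp: inj_on_def)

lemma mass_shift:
  fixes a :: "'a::real_normed_vector \<Rightarrow> real"
  shows "mass (\<lambda>z. a (z - v)) = mass a"
  by (simp add: mass_def sum_supp_shift)

lemma atomic_le_mass:
  assumes "atomic a" shows "a x \<le> mass a"
proof (cases "x \<in> supp a")
  case True
  then show ?thesis
    using assms unfolding mass_def by (intro member_le_sum) (auto simp: atomic_def)
next
  case False
  then show ?thesis
    using assms by (auto simp: mass_def atomic_def supp_def intro!: sum_nonneg)
qed

lemma atomic_mix:
  assumes "atomic a" "atomic b" "0 \<le> s" "0 \<le> t"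
  shows "atomic (\<lambda>x. s * a x + t * b x)"
proof -
  have "supp (\<lambda>x. s * a x + t * b x) \<subseteq> supp a \<union> supp b" by (auto simp: supp_def)
  then show ?thesis
    using assms by (auto simp: atomic_def intro: finite_subset)
qed

lemma sum_supp_mix:
  fixes f :: "'a \<Rightarrow> real"
  assumes "atomic a" "atomic b"
  shows "(\<Sum>x\<in>supp (\<lambda>x. s * a x + t * b x). (s * a x + t * b x) * f x)
    = s * (\<Sum>x\<in>supp a. a x * f x) + t * (\<Sum>x\<in>supp b. b x * f x)"
proof -
  let ?S = "supp a \<union> supp b"
  have fin: "finite ?S" using assms by (simp add: atomic_def)
  have "(\<Sum>x\<in>supp (\<lambda>x. s * a x + t * b x). (s * a x + t * b x) * f x)
      = (\<Sum>x\<in>?S. (s * a x + t * b x) * f x)"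
    by (rule sum.mono_neutral_left[OF fin]) (auto simp: supp_def)
  also have "\<dots> = s * (\<Sum>x\<in>?S. a x * f x) + t * (\<Sum>x\<in>?S. b x * f x)"
    by (simp add: sum_distrib_left distrib_right sum.distrib mult.assoc)
  also have "(\<Sum>x\<in>?S. a x * f x) = (\<Sum>x\<in>supp a. a x * f x)"
    by (rule sum.mono_neutral_right[OF fin]) (auto simp: supp_def)
  also have "(\<Sum>x\<in>?S. b x * f x) = (\<Sum>x\<in>supp b. b x * f x)"
    by (rule sum.mono_neutral_right[OF fin]) (auto simp: supp_def)
  finally show ?thesis .
qed

lemma mass_mix:
  "atomic a \<Longrightarrow> atomic b \<Longrightarrow> mass (\<lambda>x. s * a x + t * b x) = s * mass a + t * mass b"
  using sum_supp_mix[of a b s t "\<lambda>_. 1"] by (simp add: mass_def)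

lemma atomic_partitionD:
  assumes "atomic_partition a b p" "x \<in> supp a"
  shows "atomic (p x)" "mass (p x) = a x"
  using assms by (auto simp: atomic_partition_def)

text \<open>At most one piece charges a given point. Consequently sums of powers of the pieces'
  masses, which are not additive in the mass, can still be rewritten as sums over the atoms of
  \<open>b\<close>.\<close>

lemma atomic_partition_value:
  assumes p: "atomic_partition a b p" and a: "atomic a" and x: "x \<in> supp a" and y: "y \<in> supp (p x)"
  shows "b y = p x y"
proof -
  have "p x' y = 0" if "x' \<in> supp a" "x' \<noteq> x" for x'
    using p x y that unfolding atomic_partition_def by (auto simp: supp_def)
  then have "(\<Sum>x'\<in>supp a. p x' y) = (\<Sum>x'\<in>{x}. p x' y)"
    using x a by (intro sum.mono_neutral_right) (auto simp: atomic_def)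
  then show ?thesis using p by (simp add: atomic_partition_def)
qed

lemma supp_atomic_partition:
  assumes p: "atomic_partition a b p" and a: "atomic a"
  shows "supp b = (\<Union>x\<in>supp a. supp (p x))"
proof
  show "supp b \<subseteq> (\<Union>x\<in>supp a. supp (p x))"
  proof
    fix y assume "y \<in> supp b"
    then have "(\<Sum>x\<in>supp a. p x y) \<noteq> 0" using p by (simp add: supp_def atomic_partition_def)
    then show "y \<in> (\<Union>x\<in>supp a. supp (p x))" by (auto simp: supp_def dest: sum.not_neutral_contains_not_neutral)
  qed
  show "(\<Union>x\<in>supp a. supp (p x)) \<subseteq> supp b"
    using atomic_partition_value[OF p a] by (auto simp: supp_def)
qed

section \<open>Refinement by acyclic paths on copies, and its behaviour under the basic
  operations\<close>

definition copy_refines_within ::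
    "real \<Rightarrow> real \<Rightarrow> ('a::metric_space \<Rightarrow> real) \<Rightarrow> ('a \<Rightarrow> real) \<Rightarrow> bool" where
  "copy_refines_within \<alpha> \<epsilon> a b \<longleftrightarrow> (\<exists>p G. atomic_partition a b p \<and>
     (\<forall>x\<in>supp a. G x \<in> copy_transport_paths (point_atom (a x) x) (p x)) \<and>
     (\<Sum>x\<in>supp a. M_cost \<alpha> fst (G x)) \<le> \<epsilon>)"

lemma refines_within_iff_copy:
  assumes "\<alpha> \<le> 1"
  shows "refines_within \<alpha> \<epsilon> a b \<longleftrightarrow> copy_refines_within \<alpha> \<epsilon> a b"
proof (cases "0 \<le> \<alpha>")
  case False
  then show ?thesis unfolding refines_within_def copy_refines_within_def by auto
next
  case True
  have fin: "finite (supp (point_atom m x))" for m x by (simp add: supp_point_atom)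
  show ?thesis
  proof
    assume "refines_within \<alpha> \<epsilon> a b"
    then obtain p G where p: "atomic_partition a b p"
      and G: "\<forall>x\<in>supp a. G x \<in> transport_paths (point_atom (a x) x) (p x)"
      and cost: "(\<Sum>x\<in>supp a. M_cost \<alpha> (\<lambda>v. v) (G x)) \<le> \<epsilon>"
      using True by (auto simp: refines_within_def)
    have "\<forall>x\<in>supp a. \<exists>H. H \<in> copy_transport_paths (point_atom (a x) x) (p x)
        \<and> M_cost \<alpha> fst H \<le> M_cost \<alpha> (\<lambda>v. v) (G x)"
      using transport_path_imp_copy_path[OF _ fin _ True] G atomic_partitionD(1)[OF p]
      unfolding atomic_def by blast
    then obtain H where H: "\<forall>x\<in>supp a. H x \<in> copy_transport_paths (point_atom (a x) x) (p x)
        \<and> M_cost \<alpha> fst (H x) \<le> M_cost \<alpha> (\<lambda>v. v) (G x)"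
      by (metis (no_types))
    then have "(\<Sum>x\<in>supp a. M_cost \<alpha> fst (H x)) \<le> \<epsilon>"
      using cost by (intro order_trans[OF sum_mono cost]) auto
    then show "copy_refines_within \<alpha> \<epsilon> a b"
      using p H unfolding copy_refines_within_def by blast
  next
    assume "copy_refines_within \<alpha> \<epsilon> a b"
    then obtain p G where p: "atomic_partition a b p"
      and G: "\<forall>x\<in>supp a. G x \<in> copy_transport_paths (point_atom (a x) x) (p x)"
      and cost: "(\<Sum>x\<in>supp a. M_cost \<alpha> fst (G x)) \<le> \<epsilon>"
      by (auto simp: copy_refines_within_def)
    have "\<forall>x\<in>supp a. \<exists>H. H \<in> transport_paths (point_atom (a x) x) (p x)
        \<and> M_cost \<alpha> (\<lambda>v. v) H \<le> M_cost \<alpha> fst (G x)"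
      using copy_path_imp_transport_path[OF _ fin _ assms] G atomic_partitionD(1)[OF p]
      unfolding atomic_def by blast
    then obtain H where H: "\<forall>x\<in>supp a. H x \<in> transport_paths (point_atom (a x) x) (p x)
        \<and> M_cost \<alpha> (\<lambda>v. v) (H x) \<le> M_cost \<alpha> fst (G x)"
      by (metis (no_types))
    then have "(\<Sum>x\<in>supp a. M_cost \<alpha> (\<lambda>v. v) (H x)) \<le> \<epsilon>"
      using cost by (intro order_trans[OF sum_mono cost]) auto
    then show "refines_within \<alpha> \<epsilon> a b"
      using p H True unfolding refines_within_def by auto
  qed
qed

lemma copy_refines_within_mono:
  assumes "copy_refines_within \<alpha> \<epsilon> a b" and a: "atomic a" "mass a \<le> 1" and "\<alpha> \<le> \<beta>"
  shows "copy_refines_within \<beta> \<epsilon> a b"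
proof -
  obtain p G where p: "atomic_partition a b p"
    and G: "\<forall>x\<in>supp a. G x \<in> copy_transport_paths (point_atom (a x) x) (p x)"
    and cost: "(\<Sum>x\<in>supp a. M_cost \<alpha> fst (G x)) \<le> \<epsilon>"
    using assms(1) by (auto simp: copy_refines_within_def)
  have "M_cost \<beta> fst (G x) \<le> M_cost \<alpha> fst (G x)" if x: "x \<in> supp a" for x
    using G x atomic_partitionD[OF p x] atomic_le_mass[OF a(1), of x] a assms(4)
    by (intro copy_path_M_cost_antimono[of "G x" "point_atom (a x) x" "p x"])
      (auto simp: atomic_point_atom atomic_def[of a])
  then have "(\<Sum>x\<in>supp a. M_cost \<beta> fst (G x)) \<le> \<epsilon>"
    by (intro order_trans[OF sum_mono cost])
  then show ?thesis using p G unfolding copy_refines_within_def by blast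
qed

text \<open>The path issuing from \<open>x\<close> pays for moving its one source atom and the atoms
  of its piece. As the pieces have disjoint supports, the latter costs add up to a sum over the
  atoms of \<open>b\<close>. The extra cost therefore does not depend on the partition, so
  \<open>u\<close> and \<open>v\<close> can be fixed before any partition is known.\<close>

lemma copy_refines_within_shift:
  fixes a b :: "'a::real_normed_vector \<Rightarrow> real"
  assumes "copy_refines_within \<alpha> \<epsilon> a b" and a: "atomic a" and uv: "u \<noteq> 0" "v \<noteq> 0"
  shows "copy_refines_within \<alpha> (\<epsilon> + norm u * (\<Sum>x\<in>supp a. a x powr \<alpha>) + norm v * (\<Sum>y\<in>supp b. b y powr \<alpha>))
    (\<lambda>z. a (z - u)) (\<lambda>z. b (z - v))"
proof -
  obtain p G where p: "atomic_partition a b p"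
    and G: "\<forall>x\<in>supp a. G x \<in> copy_transport_paths (point_atom (a x) x) (p x)"
    and cost: "(\<Sum>x\<in>supp a. M_cost \<alpha> fst (G x)) \<le> \<epsilon>"
    using assms(1) by (auto simp: copy_refines_within_def)
  have px: "atomic (p x)" "mass (p x) = a x" if "x \<in> supp a" for x
    using atomic_partitionD[OF p that] by auto
  have p': "atomic_partition (\<lambda>z. a (z - u)) (\<lambda>z. b (z - v)) (\<lambda>x z. p (x - u) (z - v))"
    unfolding atomic_partition_def
  proof (intro conjI ballI impI)
    fix x assume "x \<in> supp (\<lambda>z. a (z - u))"
    then have x: "x - u \<in> supp a" by (auto simp: supp_shift)
    then show "atomic (\<lambda>z. p (x - u) (z - v))" "mass (\<lambda>z. p (x - u) (z - v)) = a (x - u)"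
      using px by (auto simp: atomic_shift mass_shift)
    fix x' assume x': "x' \<in> supp (\<lambda>z. a (z - u))" and ne: "x \<noteq> x'"
    from x' have x': "x' - u \<in> supp a" by (auto simp: supp_shift)
    have "supp (p (x - u)) \<inter> supp (p (x' - u)) = {}"
      using p x x' ne unfolding atomic_partition_def by auto
    then show "supp (\<lambda>z. p (x - u) (z - v)) \<inter> supp (\<lambda>z. p (x' - u) (z - v)) = {}"
      by (auto simp: supp_def)
  next
    show "(\<lambda>z. b (z - v)) = (\<lambda>y. \<Sum>x\<in>supp (\<lambda>z. a (z - u)). p (x - u) (y - v))"
      using p by (simp add: sum_supp_shift atomic_partition_def)
  qed
  define c where "c = (\<lambda>x. M_cost \<alpha> fst (G x) + norm u * a x powr \<alpha>
      + norm v * (\<Sum>y\<in>supp (p x). p x y powr \<alpha>))"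
  have "\<forall>x\<in>supp a. \<exists>H. H \<in> copy_transport_paths (point_atom (a x) (x + u)) (\<lambda>z. p x (z - v))
      \<and> M_cost \<alpha> fst H = c x"
  proof
    fix x assume x: "x \<in> supp a"
    have pos: "0 < a x" by (rule atomic_pos[OF a x])
    have "(\<lambda>z. point_atom (a x) x (z - u)) = point_atom (a x) (x + u)"
      by (auto simp: point_atom_def fun_eq_iff algebra_simps)
    moreover have "(\<Sum>z\<in>supp (point_atom (a x) x). point_atom (a x) x z powr \<alpha>) = a x powr \<alpha>"
      using pos by (simp add: supp_point_atom) (simp add: point_atom_def)
    ultimately show "\<exists>H. H \<in> copy_transport_paths (point_atom (a x) (x + u)) (\<lambda>z. p x (z - v))
      \<and> M_cost \<alpha> fst H = c x"
      using copy_path_shift[of "G x" "point_atom (a x) x" "p x" u v \<alpha>] G x px uv pos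
      by (auto simp: c_def atomic_point_atom)
  qed
  then obtain H where H: "\<forall>x\<in>supp a. H x \<in> copy_transport_paths (point_atom (a x) (x + u)) (\<lambda>z. p x (z - v))
      \<and> M_cost \<alpha> fst (H x) = c x"
    by (metis (no_types))
  have "(\<Sum>x\<in>supp (\<lambda>z. a (z - u)). M_cost \<alpha> fst (H (x - u))) = (\<Sum>x\<in>supp a. c x)"
    using H by (simp add: sum_supp_shift)
  also have "\<dots> = (\<Sum>x\<in>supp a. M_cost \<alpha> fst (G x)) + norm u * (\<Sum>x\<in>supp a. a x powr \<alpha>)
      + norm v * (\<Sum>x\<in>supp a. \<Sum>y\<in>supp (p x). p x y powr \<alpha>)"
    by (simp add: c_def sum.distrib sum_distrib_left)
  also have "(\<Sum>x\<in>supp a. \<Sum>y\<in>supp (p x). p x y powr \<alpha>) = (\<Sum>x\<in>supp a. \<Sum>y\<in>supp (p x). b y powr \<alpha>)"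
    using atomic_partition_value[OF p a] by simp
  also have "\<dots> = (\<Sum>y\<in>supp b. b y powr \<alpha>)"
    unfolding supp_atomic_partition[OF p a] using p a px
    by (intro sum.UNION_disjoint[symmetric]) (auto simp: atomic_def atomic_partition_def)
  finally have "(\<Sum>x\<in>supp (\<lambda>z. a (z - u)). M_cost \<alpha> fst (H (x - u)))
      \<le> \<epsilon> + norm u * (\<Sum>x\<in>supp a. a x powr \<alpha>) + norm v * (\<Sum>y\<in>supp b. b y powr \<alpha>)"
    using cost by linarith
  moreover have "\<forall>x\<in>supp (\<lambda>z. a (z - u)).
      H (x - u) \<in> copy_transport_paths (point_atom (a (x - u)) x) (\<lambda>z. p (x - u) (z - v))"
    using H by (auto simp: supp_shift)
  ultimately show ?thesis
    using p' unfolding copy_refines_within_def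
    by (intro exI[of _ "\<lambda>x z. p (x - u) (z - v)"] exI[of _ "\<lambda>x. H (x - u)"]) auto
qed

lemma point_atom_scale: "(\<lambda>y. c * point_atom m x y) = point_atom (c * m) x"
  by (auto simp: point_atom_def)

lemma mass_scale: "c \<noteq> 0 \<Longrightarrow> mass (\<lambda>x. c * a x) = c * mass a"
  by (simp add: mass_def supp_scale sum_distrib_left)

lemma atomic_scale: "0 \<le> c \<Longrightarrow> atomic a \<Longrightarrow> atomic (\<lambda>x. c * a x)"
  using atomic_mix[of a a c 0] by simp

lemma copy_refines_within_scale:
  assumes "copy_refines_within \<alpha> \<epsilon> a b" and c: "0 < c"
  shows "copy_refines_within \<alpha> (c powr \<alpha> * \<epsilon>) (\<lambda>x. c * a x) (\<lambda>x. c * b x)"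
proof -
  obtain p G where p: "atomic_partition a b p"
    and G: "\<forall>x\<in>supp a. G x \<in> copy_transport_paths (point_atom (a x) x) (p x)"
    and cost: "(\<Sum>x\<in>supp a. M_cost \<alpha> fst (G x)) \<le> \<epsilon>"
    using assms(1) by (auto simp: copy_refines_within_def)
  have p': "atomic_partition (\<lambda>x. c * a x) (\<lambda>x. c * b x) (\<lambda>x y. c * p x y)"
    using p c by (auto simp: atomic_partition_def supp_scale atomic_scale mass_scale sum_distrib_left)
  have "\<forall>x\<in>supp a. \<exists>H. H \<in> copy_transport_paths (point_atom (c * a x) x) (\<lambda>y. c * p x y)
      \<and> M_cost \<alpha> fst H = c powr \<alpha> * M_cost \<alpha> fst (G x)"
    using copy_path_scale[OF _ c, of "G _" "point_atom _ _", unfolded point_atom_scale] G by blast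
  then obtain H where H: "\<forall>x\<in>supp a. H x \<in> copy_transport_paths (point_atom (c * a x) x) (\<lambda>y. c * p x y)
      \<and> M_cost \<alpha> fst (H x) = c powr \<alpha> * M_cost \<alpha> fst (G x)"
    by (metis (no_types))
  have "(\<Sum>x\<in>supp a. M_cost \<alpha> fst (H x)) \<le> c powr \<alpha> * \<epsilon>"
    using H cost by (simp add: mult_left_mono flip: sum_distrib_left)
  then show ?thesis
    using p' H c unfolding copy_refines_within_def
    by (intro exI[of _ "\<lambda>x y. c * p x y"] exI[of _ H]) (simp add: supp_scale)
qed

text \<open>Partitions and paths are put side by side. Disjointness of \<open>supp a\<close> and
  \<open>supp a'\<close> leaves each atom with its original mass and path; disjointness of
  \<open>supp b\<close> and \<open>supp b'\<close> keeps pieces of different origin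
  disjoint.\<close>

lemma copy_refines_within_add:
  assumes "copy_refines_within \<alpha> \<epsilon> a b" "copy_refines_within \<alpha> \<delta> a' b'"
    and a: "atomic a" "atomic a'" and disj: "supp a \<inter> supp a' = {}" "supp b \<inter> supp b' = {}"
  shows "copy_refines_within \<alpha> (\<epsilon> + \<delta>) (\<lambda>x. a x + a' x) (\<lambda>x. b x + b' x)"
proof -
  obtain p G where p: "atomic_partition a b p"
    and G: "\<forall>x\<in>supp a. G x \<in> copy_transport_paths (point_atom (a x) x) (p x)"
    and cost: "(\<Sum>x\<in>supp a. M_cost \<alpha> fst (G x)) \<le> \<epsilon>"
    using assms(1) by (auto simp: copy_refines_within_def)
  obtain p' G' where p': "atomic_partition a' b' p'"
    and G': "\<forall>x\<in>supp a'. G' x \<in> copy_transport_paths (point_atom (a' x) x) (p' x)"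
    and cost': "(\<Sum>x\<in>supp a'. M_cost \<alpha> fst (G' x)) \<le> \<delta>"
    using assms(2) by (auto simp: copy_refines_within_def)
  define q where "q = (\<lambda>x. if x \<in> supp a then p x else p' x)"
  define H where "H = (\<lambda>x. if x \<in> supp a then G x else G' x)"
  have zero: "a x = 0" if "x \<in> supp a'" for x using disj that by (auto simp: supp_def)
  have zero': "a' x = 0" if "x \<in> supp a" for x using disj that by (auto simp: supp_def)
  have notin: "x \<notin> supp a" if "x \<in> supp a'" for x using disj that by auto
  have supp: "supp (\<lambda>x. a x + a' x) = supp a \<union> supp a'"
    using zero zero' by (auto simp: supp_def)
  have fin: "finite (supp a)" "finite (supp a')" using a by (auto simp: atomic_def)
  have sub: "supp (p x) \<subseteq> supp b" if "x \<in> supp a" for x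
    using supp_atomic_partition[OF p a(1)] that by auto
  have sub': "supp (p' x) \<subseteq> supp b'" if "x \<in> supp a'" for x
    using supp_atomic_partition[OF p' a(2)] that by auto
  have sum_q: "(\<Sum>x\<in>supp a \<union> supp a'. if x \<in> supp a then f x else g x)
      = (\<Sum>x\<in>supp a. f x) + (\<Sum>x\<in>supp a'. g x)" for f g :: "_ \<Rightarrow> real"
    using fin disj notin by (subst sum.union_disjoint) auto
  have "atomic_partition (\<lambda>x. a x + a' x) (\<lambda>x. b x + b' x) q"
    unfolding atomic_partition_def supp
  proof (intro conjI ballI impI)
    fix x assume x: "x \<in> supp a \<union> supp a'"
    then show "atomic (q x)" "mass (q x) = a x + a' x"
      using atomic_partitionD[OF p] atomic_partitionD[OF p'] zero zero' notin by (auto simp: q_def)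
    fix x' assume x': "x' \<in> supp a \<union> supp a'" and ne: "x \<noteq> x'"
    show "supp (q x) \<inter> supp (q x') = {}"
    proof (cases "x \<in> supp a"; cases "x' \<in> supp a")
      assume "x \<in> supp a" "x' \<in> supp a"
      then show ?thesis using p ne by (simp add: q_def atomic_partition_def)
    next
      assume "x \<notin> supp a" "x' \<notin> supp a"
      then show ?thesis using p' ne x x' by (simp add: q_def atomic_partition_def)
    next
      assume "x \<in> supp a" "x' \<notin> supp a"
      then show ?thesis using sub[of x] sub'[of x'] x' disj by (auto simp: q_def)
    next
      assume "x \<notin> supp a" "x' \<in> supp a"
      then show ?thesis using sub[of x'] sub'[of x] x disj by (auto simp: q_def)
    qed
  next
    have "b y + b' y = (\<Sum>x\<in>supp a \<union> supp a'. q x y)" for y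
      using p p' sum_q[of "\<lambda>x. p x y" "\<lambda>x. p' x y"]
      by (simp add: q_def atomic_partition_def if_distrib[of "\<lambda>f. f y"])
    then show "(\<lambda>x. b x + b' x) = (\<lambda>y. \<Sum>x\<in>supp a \<union> supp a'. q x y)" by auto
  qed
  moreover have "\<forall>x\<in>supp a \<union> supp a'. H x \<in> copy_transport_paths (point_atom (a x + a' x) x) (q x)"
    using G G' zero zero' notin by (auto simp: H_def q_def)
  moreover have "(\<Sum>x\<in>supp a \<union> supp a'. M_cost \<alpha> fst (H x)) \<le> \<epsilon> + \<delta>"
    using cost cost' sum_q[of "\<lambda>x. M_cost \<alpha> fst (G x)" "\<lambda>x. M_cost \<alpha> fst (G' x)"]
    by (simp add: H_def if_distrib[of "M_cost \<alpha> fst"])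
  ultimately show ?thesis
    unfolding copy_refines_within_def supp by blast
qed

text \<open>A single vertex without edges is both source and sink, at cost 0 for every
  \<alpha>.\<close>

lemma copy_refines_within_point_atom:
  assumes "0 \<le> \<epsilon>"
  shows "copy_refines_within \<alpha> \<epsilon> (point_atom 1 x) (point_atom 1 x)"
proof -
  define G :: "('a \<times> nat) wdigraph" where "G = \<lparr>verts = {(x, 0)}, edges = {}, weight = \<lambda>_. 1\<rparr>"
  have "G \<in> copy_transport_paths (point_atom 1 x) (point_atom 1 x)"
    by (rule copy_pathI[where s = "\<lambda>x. (x, 0)" and t = "\<lambda>x. (x, 0)"])
      (auto simp: G_def wdigraph_def supp_point_atom balanced_def acyclic_def)
  moreover have "atomic_partition (point_atom 1 x) (point_atom 1 x) (\<lambda>_. point_atom 1 x)"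
    by (auto simp: atomic_partition_def supp_point_atom atomic_point_atom mass_point_atom)
      (simp add: point_atom_def)
  moreover have "M_cost \<alpha> fst G = 0" by (simp add: M_cost_def G_def)
  ultimately show ?thesis
    using assms unfolding copy_refines_within_def
    by (intro exI[of _ "\<lambda>_. point_atom 1 x"] exI[of _ "\<lambda>_. G"])
      (auto simp: supp_point_atom, auto simp: point_atom_def)
qed

section \<open>Convexity of the spaces of limits\<close>

lemma copy_refines_within_weaken:
  "copy_refines_within \<alpha> \<epsilon> a b \<Longrightarrow> \<epsilon> \<le> \<delta> \<Longrightarrow> copy_refines_within \<alpha> \<delta> a b"
  unfolding copy_refines_within_def by (meson order_trans)

section \<open>Weak limits of atomic measures\<close>

lemma borel_probsD:
  assumes "\<mu> \<in> borel_probs"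
  shows "prob_space \<mu>" "sets \<mu> = sets borel" "space \<mu> = UNIV"
  using assms sets_eq_imp_space_eq[of \<mu> borel] by (auto simp: borel_probs_def)

lemma integral_atomic_measure:
  fixes f :: "'a::topological_space \<Rightarrow> real"
  assumes "atomic a" "f \<in> borel_measurable borel"
  shows "integral\<^sup>L (atomic_measure a) f = (\<Sum>x\<in>supp a. a x * f x)"
proof -
  have "integral\<^sup>L (atomic_measure a) f = integral\<^sup>L (point_measure (supp a) (\<lambda>x. ennreal (a x))) f"
    unfolding atomic_measure_def
    by (rule integral_distr) (use assms in \<open>auto simp: measurable_def space_point_measure sets_point_measure\<close>)
  also have "\<dots> = (\<Sum>x\<in>supp a. a x * f x)"
    using assms(1) by (subst lebesgue_integral_point_measure_finite) (auto simp: atomic_def)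
  finally show ?thesis .
qed

definition atomic_tendsto :: "(nat \<Rightarrow> 'a::topological_space \<Rightarrow> real) \<Rightarrow> 'a measure \<Rightarrow> bool" where
  "atomic_tendsto a \<mu> \<longleftrightarrow> (\<forall>f :: 'a \<Rightarrow> real. continuous_on UNIV f \<and> bounded (range f) \<longrightarrow>
     (\<lambda>k. \<Sum>x\<in>supp (a k). a k x * f x) \<longlonglongrightarrow> integral\<^sup>L \<mu> f)"

lemma converges_weakly_atomic_measure:
  assumes "\<And>k. atomic (a k)"
  shows "converges_weakly (\<lambda>k. atomic_measure (a k)) \<mu> \<longleftrightarrow> atomic_tendsto a \<mu>"
  unfolding converges_weakly_def atomic_tendsto_def
  using assms by (auto simp: integral_atomic_measure borel_measurable_continuous_onI)

definition copy_Cauchy :: "real \<Rightarrow> (nat \<Rightarrow> 'a::metric_space \<Rightarrow> real) \<Rightarrow> bool" where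
  "copy_Cauchy \<alpha> a \<longleftrightarrow> (\<forall>\<epsilon>>0. \<exists>N. \<forall>k\<ge>N. \<forall>n>k. copy_refines_within \<alpha> \<epsilon> (a k) (a n))"

lemma D_space_iff:
  assumes "\<alpha> \<le> 1"
  shows "\<mu> \<in> D_space \<alpha> \<longleftrightarrow> \<mu> \<in> borel_probs \<and>
    (\<exists>a. (\<forall>k. atomic (a k) \<and> mass (a k) = 1) \<and> copy_Cauchy \<alpha> a \<and> atomic_tendsto a \<mu>)"
proof -
  have "admissible_Cauchy \<alpha> a \<and> (\<forall>k. mass (a k) = 1) \<and> converges_weakly (\<lambda>k. atomic_measure (a k)) \<mu>
    \<longleftrightarrow> (\<forall>k. atomic (a k) \<and> mass (a k) = 1) \<and> copy_Cauchy \<alpha> a \<and> atomic_tendsto a \<mu>" for a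
    unfolding admissible_Cauchy_def copy_Cauchy_def refines_within_iff_copy[OF assms]
    using converges_weakly_atomic_measure[of a \<mu>] by auto
  then show ?thesis unfolding D_space_def by simp
qed

lemma D_space_mono:
  assumes "\<alpha> \<le> \<beta>" "\<beta> \<le> 1"
  shows "D_space \<alpha> \<subseteq> D_space \<beta>"
proof
  fix \<mu> :: "'a measure" assume "\<mu> \<in> D_space \<alpha>"
  then obtain a where "\<mu> \<in> borel_probs" and a: "\<And>k. atomic (a k) \<and> mass (a k) = 1"
    and C: "copy_Cauchy \<alpha> a" and "atomic_tendsto a \<mu>"
    using assms by (auto simp: D_space_iff)
  moreover have "copy_refines_within \<beta> \<epsilon> (a k) (a n)" if "copy_refines_within \<alpha> \<epsilon> (a k) (a n)" for \<epsilon> k n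
    using a[of k] assms(1) by (intro copy_refines_within_mono[OF that]) auto
  then have "copy_Cauchy \<beta> a" using C unfolding copy_Cauchy_def by meson
  ultimately show "\<mu> \<in> D_space \<beta>"
    using assms(2) by (auto simp: D_space_iff)
qed

text \<open>A constant sequence represents the Dirac measure for every exponent, however negative.
  This puts the zero signed measure into every \<open>S_space \<alpha>\<close>.\<close>

lemma return_in_D_space:
  assumes "\<alpha> \<le> 1"
  shows "return borel x \<in> D_space \<alpha>"
  unfolding D_space_iff[OF assms]
proof (intro conjI exI[of _ "\<lambda>_. point_atom 1 x"] allI)
  show "return borel x \<in> borel_probs" by (simp add: borel_probs_def prob_space_return)
  show "copy_Cauchy \<alpha> (\<lambda>_. point_atom 1 x)"
    by (auto simp: copy_Cauchy_def intro!: copy_refines_within_point_atom)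
  show "atomic_tendsto (\<lambda>_. point_atom 1 x) (return borel x)"
    unfolding atomic_tendsto_def
    by (auto simp: supp_point_atom integral_return borel_measurable_continuous_onI)
      (auto simp: point_atom_def)
qed (simp_all add: atomic_point_atom mass_point_atom)

text \<open>The mixture is the law of a two-stage experiment: a Bernoulli variable selects \<mu> or
  \<nu>, from which a point is drawn. The formula for \<open>measure\<close> is needed for all sets,
  since signed measures are compared as functions on all sets; on non-Borel sets it reads 0 =
  0.\<close>

lemma exists_borel_mix:
  fixes \<mu> \<nu> :: "'a::topological_space measure"
  assumes \<mu>: "\<mu> \<in> borel_probs" and \<nu>: "\<nu> \<in> borel_probs" and t: "0 \<le> t" "t \<le> 1"
  obtains M where "M \<in> borel_probs"
    "\<And>A. measure M A = t * measure \<mu> A + (1 - t) * measure \<nu> A"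
    "\<And>f :: 'a \<Rightarrow> real. f \<in> borel_measurable borel \<Longrightarrow> bounded (range f) \<Longrightarrow>
      integral\<^sup>L M f = t * integral\<^sup>L \<mu> f + (1 - t) * integral\<^sup>L \<nu> f"
proof
  let ?N = "\<lambda>b. if b then \<mu> else \<nu>"
  define M where "M = measure_pmf (bernoulli_pmf t) \<bind> ?N"
  note \<mu>D = borel_probsD[OF \<mu>] and \<nu>D = borel_probsD[OF \<nu>]
  have N: "?N \<in> measurable (measure_pmf (bernoulli_pmf t)) (subprob_algebra borel)"
    using \<mu>D \<nu>D by (auto simp: space_subprob_algebra prob_space_imp_subprob_space)
  have sets: "sets M = sets borel"
    unfolding M_def using \<mu>D \<nu>D by (intro sets_bind) auto
  have "prob_space M"
    unfolding M_def using \<mu>D \<nu>D by (intro measure_pmf.prob_space_bind[OF _ N]) auto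
  with sets show "M \<in> borel_probs" by (simp add: borel_probs_def)
  show "measure M A = t * measure \<mu> A + (1 - t) * measure \<nu> A" for A
  proof (cases "A \<in> sets borel")
    case True
    then show ?thesis
      unfolding M_def using t by (subst measure_pmf.measure_bind[OF N]) auto
  next
    case False
    then show ?thesis using sets \<mu>D \<nu>D by (simp add: measure_notin_sets)
  qed
  fix f :: "'a \<Rightarrow> real" assume f: "f \<in> borel_measurable borel" and "bounded (range f)"
  then obtain B where B: "\<And>x. \<bar>f x\<bar> \<le> B" by (auto simp: bounded_iff)
  have "integral\<^sup>L M f = (\<integral>b. integral\<^sup>L (?N b) f \<partial>measure_pmf (bernoulli_pmf t))"
    unfolding M_def
  proof (rule integral_bind[OF f _ N, where B' = 1])
    show "\<bar>f x\<bar> \<le> B" for x by (rule B)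
    show "AE x in measure_pmf (bernoulli_pmf t). emeasure (?N x) (space (?N x)) \<le> ennreal 1"
      using \<mu>D \<nu>D by (auto simp: prob_space.emeasure_space_1)
  qed (rule measure_pmf.finite_measure)
  also have "\<dots> = t * integral\<^sup>L \<mu> f + (1 - t) * integral\<^sup>L \<nu> f"
    using t by simp
  finally show "integral\<^sup>L M f = t * integral\<^sup>L \<mu> f + (1 - t) * integral\<^sup>L \<nu> f" .
qed

text \<open>Continuity from below along the balls of integer radius, which exhaust the
  space.\<close>

lemma borel_prob_tight:
  fixes \<mu> :: "'a::real_normed_vector measure"
  assumes "\<mu> \<in> borel_probs" "0 < \<epsilon>"
  obtains R where "1 - \<epsilon> < measure \<mu> (cball 0 R)"
proof -
  interpret prob_space \<mu> using assms by (intro borel_probsD)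
  have "(\<lambda>n. measure \<mu> (cball 0 (real n))) \<longlonglongrightarrow> measure \<mu> (\<Union>n. cball 0 (real n))"
    by (rule finite_Lim_measure_incseq) (auto simp: borel_probsD[OF assms(1)] incseq_def)
  also have "(\<Union>n. cball (0::'a) (real n)) = space \<mu>"
    using real_arch_simple by (auto simp: borel_probsD[OF assms(1)])
  finally have "(\<lambda>n. measure \<mu> (cball 0 (real n))) \<longlonglongrightarrow> 1" by (simp add: prob_space)
  then have "\<forall>\<^sub>F n in sequentially. 1 - \<epsilon> < measure \<mu> (cball 0 (real n))"
    by (rule order_tendstoD) (use assms in auto)
  then show thesis using that by (auto simp: eventually_sequentially)
qed

text \<open>
  A bounded continuous test function need not be uniformly continuous; the translation is harmless
  on a large ball, and weak convergence against a cutoff function controls the mass outside it.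
\<close>

lemma atomic_tendsto_shift:
  fixes a :: "nat \<Rightarrow> 'a::euclidean_space \<Rightarrow> real"
  assumes a: "\<And>k. atomic (a k) \<and> mass (a k) = 1" and \<mu>: "\<mu> \<in> borel_probs"
    and lim: "atomic_tendsto a \<mu>" and v: "v \<longlonglongrightarrow> 0"
  shows "atomic_tendsto (\<lambda>k z. a k (z - v k)) \<mu>"
  unfolding atomic_tendsto_def
proof (intro allI impI)
  fix f :: "'a \<Rightarrow> real" assume f: "continuous_on UNIV f \<and> bounded (range f)"
  then obtain B where B: "0 < B" "\<And>x. \<bar>f x\<bar> \<le> B" by (auto simp: bounded_pos)
  interpret prob_space \<mu> using \<mu> by (rule borel_probsD)
  let ?d = "\<lambda>k. \<Sum>y\<in>supp (a k). a k y * (f (y + v k) - f y)"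
  have "?d \<longlonglongrightarrow> 0"
  proof (rule LIMSEQ_I)
    fix \<epsilon> :: real assume "0 < \<epsilon>"
    \<comment> \<open>Chosen so that \<open>\<eta> + 2 * B * \<eta> = \<epsilon>\<close>: \<eta> for
      the oscillation of \<open>f\<close> on a large ball, and \<open>2 * B\<close> times a mass of
      at most \<eta> outside it.\<close>
    define \<eta> where "\<eta> = \<epsilon> / (1 + 2 * B)"
    have \<eta>: "0 < \<eta>" "\<eta> + 2 * B * \<eta> = \<epsilon>"
    proof -
      have "0 < 1 + 2 * B" using B(1) by simp
      then show "0 < \<eta>" "\<eta> + 2 * B * \<eta> = \<epsilon>"
        using \<open>0 < \<epsilon>\<close> nonzero_mult_div_cancel_left[of "1 + 2 * B" \<epsilon>]
        by (simp_all add: \<eta>_def distrib_right flip: add_divide_distrib)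
    qed
    obtain R where R: "1 - \<eta> < measure \<mu> (cball 0 R)"
      using borel_prob_tight[OF \<mu> \<eta>(1)] .
    \<comment> \<open>A continuous cutoff, 1 on \<open>cball 0 R\<close> and 0 from radius
      \<open>R + 1\<close> on. The indicator of a ball would not be an admissible test
      function.\<close>
    define \<psi> where "\<psi> = (\<lambda>y :: 'a. max 0 (min 1 (R + 1 - norm y)))"
    have \<psi>: "0 \<le> \<psi> y" "\<psi> y \<le> 1" for y by (auto simp: \<psi>_def)
    have \<psi>_cont: "continuous_on UNIV \<psi>" unfolding \<psi>_def by (intro continuous_intros)
    have \<psi>_meas: "\<psi> \<in> borel_measurable \<mu>"
      using borel_measurable_continuous_onI[OF \<psi>_cont] measurable_cong_sets[OF borel_probsD(2)[OF \<mu>] refl]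
      by blast
    have "bounded (range \<psi>)" using \<psi> by (auto simp: bounded_iff intro!: exI[of _ 1])
    then have \<psi>_lim: "(\<lambda>k. \<Sum>y\<in>supp (a k). a k y * \<psi> y) \<longlonglongrightarrow> integral\<^sup>L \<mu> \<psi>"
      using lim \<psi>_cont by (auto simp: atomic_tendsto_def)
    have "1 - \<eta> < measure \<mu> (cball 0 R)" by (rule R)
    also have "\<dots> = (\<integral>y. indicator (cball 0 R) y \<partial>\<mu>)"
      by (simp add: borel_probsD[OF \<mu>])
    also have "\<dots> \<le> integral\<^sup>L \<mu> \<psi>"
    proof (rule integral_mono)
      show "integrable \<mu> (indicator (cball 0 R) :: 'a \<Rightarrow> real)"
        by (simp add: borel_probsD[OF \<mu>] emeasure_eq_measure)
      show "integrable \<mu> \<psi>"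
        using \<psi> \<psi>_meas by (intro integrable_const_bound[where B = 1]) auto
      show "indicator (cball 0 R) y \<le> \<psi> y" for y
        by (auto simp: \<psi>_def indicator_def)
    qed
    finally have mass_ev: "\<forall>\<^sub>F k in sequentially. 1 - \<eta> < (\<Sum>y\<in>supp (a k). a k y * \<psi> y)"
      by (rule order_tendstoD(1)[OF \<psi>_lim])
    \<comment> \<open>Points of norm below \<open>R + 1\<close> are moved by less than 1, so
      \<open>R + 2\<close> contains them before and after the translation.\<close>
    have "uniformly_continuous_on (cball 0 (R + 2)) f"
      using f by (intro compact_uniformly_continuous) (auto intro: continuous_on_subset)
    then obtain \<delta> where \<delta>: "0 < \<delta>"
      "\<And>y z. y \<in> cball 0 (R + 2) \<Longrightarrow> z \<in> cball 0 (R + 2) \<Longrightarrow> dist z y < \<delta> \<Longrightarrow> dist (f z) (f y) < \<eta>"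
      unfolding uniformly_continuous_on_def using \<eta>(1) by meson
    have "\<forall>\<^sub>F k in sequentially. norm (v k) < min \<delta> 1"
      using tendsto_norm_zero[OF v] \<delta>(1) by (intro order_tendstoD(2)) auto
    with mass_ev have "\<forall>\<^sub>F k in sequentially. norm (?d k - 0) < \<epsilon>"
    proof eventually_elim
      case (elim k)
      have ak: "0 \<le> a k y" for y using a[of k] by (simp add: atomic_def)
      \<comment> \<open>Near the origin uniform continuity gives \<eta> and the second term is
        merely nonnegative; far out \<psi> vanishes and the trivial bound \<open>2 * B\<close>
        suffices.\<close>
      have *: "\<bar>f (y + v k) - f y\<bar> \<le> \<eta> + 2 * B * (1 - \<psi> y)" for y
      proof (cases "norm y < R + 1")
        case True
        have "norm (y + v k) \<le> R + 2" using True elim norm_triangle_ineq[of y "v k"] by linarith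
        then have "dist (f (y + v k)) (f y) < \<eta>"
          using True elim by (intro \<delta>(2)) (auto simp: dist_norm[of _ y])
        moreover have "0 \<le> 2 * B * (1 - \<psi> y)" using B(1) \<psi>(2)[of y] by simp
        ultimately show ?thesis by (simp add: dist_real_def)
      next
        case False
        then have "\<psi> y = 0" by (simp add: \<psi>_def)
        then show ?thesis using B(2)[of y] B(2)[of "y + v k"] \<eta>(1) by simp
      qed
      have "norm (?d k - 0) \<le> (\<Sum>y\<in>supp (a k). a k y * (\<eta> + 2 * B * (1 - \<psi> y)))"
        unfolding diff_0_right using * ak
        by (intro sum_norm_le) (simp add: abs_mult mult_left_mono del: right_diff_distrib)
      also have "\<dots> = (\<eta> + 2 * B) * mass (a k) - 2 * B * (\<Sum>y\<in>supp (a k). a k y * \<psi> y)"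
        by (simp add: mass_def sum_distrib_left algebra_simps flip: sum.distrib sum_subtractf)
      also have "\<dots> < (\<eta> + 2 * B) * 1 - 2 * B * (1 - \<eta>)"
        using elim B(1) a[of k] by simp
      also have "\<dots> = \<epsilon>" using \<eta>(2) by (simp add: algebra_simps)
      finally show ?case .
    qed
    then show "\<exists>N. \<forall>k\<ge>N. norm (?d k - 0) < \<epsilon>" by (simp add: eventually_sequentially)
  qed
  moreover have "(\<lambda>k. \<Sum>y\<in>supp (a k). a k y * f y) \<longlonglongrightarrow> integral\<^sup>L \<mu> f"
    using lim f by (auto simp: atomic_tendsto_def)
  ultimately have "(\<lambda>k. ?d k + (\<Sum>y\<in>supp (a k). a k y * f y)) \<longlonglongrightarrow> 0 + integral\<^sup>L \<mu> f"
    by (rule tendsto_add)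
  then show "(\<lambda>k. \<Sum>z\<in>supp (\<lambda>z. a k (z - v k)). a k (z - v k) * f z) \<longlonglongrightarrow> integral\<^sup>L \<mu> f"
    by (simp add: sum_supp_shift right_diff_distrib flip: sum.distrib)
qed

text \<open>Euclidean spaces have positive dimension, so balls are infinite and no finite set
  exhausts them.\<close>

lemma exists_small_nonzero_avoiding:
  fixes F :: "'a::euclidean_space set"
  assumes "finite F" "0 < \<eta>"
  shows "\<exists>v. v \<noteq> 0 \<and> norm v < \<eta> \<and> v \<notin> F"
proof -
  have "infinite (ball (0::'a) \<eta>)"
    using islimpt_UNIV[of "0::'a"] assms(2) by (auto simp: islimpt_eq_infinite_ball)
  then have "ball (0::'a) \<eta> - insert 0 F \<noteq> {}"
    using assms(1) by (metis finite_insert infinite_imp_nonempty Diff_infinite_finite)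
  then show ?thesis by auto
qed

text \<open>
  The pieces of a partition must have disjoint supports, so the atoms of one of the two
  approximating sequences are first moved off those of the other.
\<close>

lemma D_space_mix:
  fixes \<mu> \<nu> :: "'a::euclidean_space measure"
  assumes \<alpha>: "\<alpha> \<le> 1" and \<mu>: "\<mu> \<in> D_space \<alpha>" and \<nu>: "\<nu> \<in> D_space \<alpha>" and t: "0 < t" "t < 1"
  obtains M where "M \<in> D_space \<alpha>" "\<And>A. measure M A = t * measure \<mu> A + (1 - t) * measure \<nu> A"
proof -
  from \<mu> \<alpha> obtain a where \<mu>p: "\<mu> \<in> borel_probs" and a: "\<And>k. atomic (a k) \<and> mass (a k) = 1"
    and Ca: "copy_Cauchy \<alpha> a" and lima: "atomic_tendsto a \<mu>"
    by (auto simp: D_space_iff)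
  from \<nu> \<alpha> obtain b where \<nu>p: "\<nu> \<in> borel_probs" and b: "\<And>k. atomic (b k) \<and> mass (b k) = 1"
    and Cb: "copy_Cauchy \<alpha> b" and limb: "atomic_tendsto b \<nu>"
    by (auto simp: D_space_iff)
  \<comment> \<open>The cost of translating all atoms of \<open>b k\<close>, per unit of
    displacement.\<close>
  define S where "S = (\<lambda>k. \<Sum>y\<in>supp (b k). b k y powr \<alpha>)"
  have S: "0 \<le> S k" for k unfolding S_def by (intro sum_nonneg) auto
  \<comment> \<open>This bound on the displacement tends to 0, which preserves the weak limit, and
    its product with \<open>S k\<close> also tends to 0, which preserves the Cauchy property. The
    summand 1 in the denominator gives the first property and keeps the quotient defined.\<close>
  define \<eta> where "\<eta> = (\<lambda>k. inverse (real (Suc k)) / (1 + S k))"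
  have \<eta>: "0 < \<eta> k" "\<eta> k \<le> inverse (real (Suc k))" "\<eta> k * S k \<le> inverse (real (Suc k))" for k
  proof -
    have "0 < 1 / (1 + S k)" "1 / (1 + S k) \<le> 1" "S k / (1 + S k) \<le> 1"
      using S[of k] by simp_all
    moreover have "0 < inverse (real (Suc k))" by simp
    ultimately show "0 < \<eta> k" "\<eta> k \<le> inverse (real (Suc k))" "\<eta> k * S k \<le> inverse (real (Suc k))"
      using mult_left_mono[of "1 / (1 + S k)" 1 "inverse (real (Suc k))"]
        mult_left_mono[of "S k / (1 + S k)" 1 "inverse (real (Suc k))"]
      by (simp_all add: \<eta>_def del: of_nat_Suc)
  qed
  \<comment> \<open>The translate of \<open>supp (b k)\<close> by v meets \<open>supp (a k)\<close>
    exactly when v is a difference of an atom of \<open>a k\<close> and one of \<open>b k\<close>;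
    only finitely many vectors are excluded.\<close>
  have "\<exists>v. v \<noteq> 0 \<and> norm v < \<eta> k \<and> v \<notin> (\<lambda>(x, y). x - y) ` (supp (a k) \<times> supp (b k))" for k
    using a[of k] b[of k] \<eta>(1)[of k] by (intro exists_small_nonzero_avoiding) (auto simp: atomic_def)
  then obtain v where v: "\<And>k. v k \<noteq> 0" "\<And>k. norm (v k) < \<eta> k"
    "\<And>k. v k \<notin> (\<lambda>(x, y). x - y) ` (supp (a k) \<times> supp (b k))"
    by metis
  define b' where "b' = (\<lambda>k z. b k (z - v k))"
  have b': "atomic (b' k)" "mass (b' k) = 1" for k
    using b[of k] by (simp_all add: b'_def atomic_shift mass_shift)
  have disj: "supp (a k) \<inter> supp (b' k) = {}" for k
  proof -
    have False if "x \<in> supp (a k)" "y \<in> supp (b k)" "x = y + v k" for x y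
      using v(3)[of k] that by (force intro: image_eqI[of _ _ "(x, y)"])
    then show ?thesis by (auto simp: b'_def supp_shift)
  qed
  have inv0: "(\<lambda>k. inverse (real (Suc k))) \<longlonglongrightarrow> 0" by (rule LIMSEQ_inverse_real_of_nat)
  have "v \<longlonglongrightarrow> 0"
  proof (rule Lim_null_comparison[OF _ inv0])
    show "\<forall>\<^sub>F k in sequentially. norm (v k) \<le> inverse (real (Suc k))"
      using order.trans[OF less_imp_le[OF v(2)] \<eta>(2)] by (intro always_eventually allI)
  qed
  then have limb': "atomic_tendsto b' \<nu>"
    unfolding b'_def using b \<nu>p limb by (intro atomic_tendsto_shift) auto
  have Cb': "copy_Cauchy \<alpha> b'"
    unfolding copy_Cauchy_def
  proof (intro allI impI)
    fix \<epsilon> :: real assume "0 < \<epsilon>"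
    \<comment> \<open>One third of \<epsilon> is for the given refinement, one for moving the atoms
      of \<open>b k\<close> and one for those of \<open>b n\<close>.\<close>
    then obtain N1 where N1: "\<And>k n. N1 \<le> k \<Longrightarrow> k < n \<Longrightarrow> copy_refines_within \<alpha> (\<epsilon> / 3) (b k) (b n)"
      using Cb unfolding copy_Cauchy_def by (meson divide_pos_pos zero_less_numeral)
    obtain N2 where N2: "\<And>k. N2 \<le> k \<Longrightarrow> inverse (real (Suc k)) < \<epsilon> / 3"
      using order_tendstoD(2)[OF inv0, of "\<epsilon> / 3"] \<open>0 < \<epsilon>\<close> by (auto simp: eventually_sequentially)
    have small: "norm (v k) * S k \<le> \<epsilon> / 3" if "N2 \<le> k" for k
    proof -
      have "norm (v k) * S k \<le> \<eta> k * S k"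
        using v(2)[of k] S by (intro mult_right_mono) auto
      with \<eta>(3)[of k] N2[OF that] show ?thesis by linarith
    qed
    have "copy_refines_within \<alpha> \<epsilon> (b' k) (b' n)" if "max N1 N2 \<le> k" "k < n" for k n
      unfolding b'_def
    proof (rule copy_refines_within_weaken[OF copy_refines_within_shift])
      show "copy_refines_within \<alpha> (\<epsilon> / 3) (b k) (b n)" using N1 that by simp
      show "\<epsilon> / 3 + norm (v k) * (\<Sum>x\<in>supp (b k). b k x powr \<alpha>)
          + norm (v n) * (\<Sum>x\<in>supp (b n). b n x powr \<alpha>) \<le> \<epsilon>"
        using small[of k] small[of n] that by (simp add: S_def)
    qed (use b v in auto)
    then show "\<exists>N. \<forall>k\<ge>N. \<forall>n>k. copy_refines_within \<alpha> \<epsilon> (b' k) (b' n)" by blast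
  qed
  define c where "c = (\<lambda>k x. t * a k x + (1 - t) * b' k x)"
  have c: "atomic (c k)" "mass (c k) = 1" for k
    using a[of k] b'[of k] t by (simp_all add: c_def atomic_mix mass_mix)
  have "copy_Cauchy \<alpha> c"
    unfolding copy_Cauchy_def
  proof (intro allI impI)
    fix \<epsilon> :: real assume \<epsilon>: "0 < \<epsilon>"
    \<comment> \<open>Scaling by c multiplies costs by \<open>c powr \<alpha>\<close>, so
      refinements within \<open>\<epsilon> / C\<close> of both sequences combine to exactly
      \<epsilon>.\<close>
    define C where "C = t powr \<alpha> + (1 - t) powr \<alpha>"
    have C: "0 < C" using t by (simp add: C_def add_pos_pos)
    obtain N1 where N1: "\<And>k n. N1 \<le> k \<Longrightarrow> k < n \<Longrightarrow> copy_refines_within \<alpha> (\<epsilon> / C) (a k) (a n)"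
      using Ca \<epsilon> C unfolding copy_Cauchy_def by (meson divide_pos_pos)
    obtain N2 where N2: "\<And>k n. N2 \<le> k \<Longrightarrow> k < n \<Longrightarrow> copy_refines_within \<alpha> (\<epsilon> / C) (b' k) (b' n)"
      using Cb' \<epsilon> C unfolding copy_Cauchy_def by (meson divide_pos_pos)
    have "copy_refines_within \<alpha> \<epsilon> (c k) (c n)" if "max N1 N2 \<le> k" "k < n" for k n
    proof -
      have "copy_refines_within \<alpha> (t powr \<alpha> * (\<epsilon> / C) + (1 - t) powr \<alpha> * (\<epsilon> / C)) (c k) (c n)"
        unfolding c_def using N1[of k n] N2[of k n] that a b' t disj
        by (intro copy_refines_within_add copy_refines_within_scale)
          (auto simp: atomic_scale supp_scale)
      moreover have "t powr \<alpha> * (\<epsilon> / C) + (1 - t) powr \<alpha> * (\<epsilon> / C) = C * (\<epsilon> / C)"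
        by (simp only: C_def distrib_right)
      ultimately show ?thesis using C by simp
    qed
    then show "\<exists>N. \<forall>k\<ge>N. \<forall>n>k. copy_refines_within \<alpha> \<epsilon> (c k) (c n)" by blast
  qed
  moreover obtain M where M: "M \<in> borel_probs"
    "\<And>A. measure M A = t * measure \<mu> A + (1 - t) * measure \<nu> A"
    "\<And>f :: 'a \<Rightarrow> real. f \<in> borel_measurable borel \<Longrightarrow> bounded (range f) \<Longrightarrow>
      integral\<^sup>L M f = t * integral\<^sup>L \<mu> f + (1 - t) * integral\<^sup>L \<nu> f"
    using exists_borel_mix[OF \<mu>p \<nu>p, of t] t by (metis less_imp_le)
  moreover have "atomic_tendsto c M"
    unfolding atomic_tendsto_def
  proof (intro allI impI)
    fix f :: "'a \<Rightarrow> real" assume f: "continuous_on UNIV f \<and> bounded (range f)"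
    have "(\<lambda>k. t * (\<Sum>x\<in>supp (a k). a k x * f x) + (1 - t) * (\<Sum>x\<in>supp (b' k). b' k x * f x))
        \<longlonglongrightarrow> t * integral\<^sup>L \<mu> f + (1 - t) * integral\<^sup>L \<nu> f"
      using lima limb' f unfolding atomic_tendsto_def by (intro tendsto_intros) auto
    then show "(\<lambda>k. \<Sum>x\<in>supp (c k). c k x * f x) \<longlonglongrightarrow> integral\<^sup>L M f"
      using a b' f M(3)[of f] by (simp add: c_def sum_supp_mix borel_measurable_continuous_onI)
  qed
  ultimately have "M \<in> D_space \<alpha>"
    unfolding D_space_iff[OF \<alpha>] using c by blast
  with M(2) show thesis by (rule that[rotated])
qed

section \<open>The distance\<close>

lemma S_spaceI:
  "0 \<le> \<Lambda> \<Longrightarrow> \<mu> \<in> D_space \<alpha> \<Longrightarrow> \<nu> \<in> D_space \<alpha> \<Longrightarrow>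
    (\<And>A. s A = \<Lambda> * (measure \<mu> A - measure \<nu> A)) \<Longrightarrow> s \<in> S_space \<alpha>"
  unfolding S_space_def measure_diff_def by blast

lemma S_spaceE:
  assumes "s \<in> S_space \<alpha>"
  obtains \<Lambda> \<mu> \<nu> where "0 \<le> \<Lambda>" "\<mu> \<in> D_space \<alpha>" "\<nu> \<in> D_space \<alpha>"
    "\<And>A. s A = \<Lambda> * (measure \<mu> A - measure \<nu> A)"
  using assms unfolding S_space_def measure_diff_def by blast

lemma S_space_mono: "\<alpha> \<le> \<beta> \<Longrightarrow> \<beta> \<le> 1 \<Longrightarrow> S_space \<alpha> \<subseteq> S_space \<beta>"
  using D_space_mono[of \<alpha> \<beta>] unfolding S_space_def by blast

lemma S_space_zero:
  assumes "\<alpha> \<le> 1" shows "(\<lambda>_. 0) \<in> S_space \<alpha>"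
  using return_in_D_space[OF assms, of undefined] by (intro S_spaceI[of 0]) auto

lemma S_space_uminus:
  assumes "s \<in> S_space \<alpha>" shows "(\<lambda>A. - s A) \<in> S_space \<alpha>"
proof -
  from assms obtain \<Lambda> \<mu> \<nu> where "0 \<le> \<Lambda>" "\<mu> \<in> D_space \<alpha>" "\<nu> \<in> D_space \<alpha>"
    and "\<And>A. s A = \<Lambda> * (measure \<mu> A - measure \<nu> A)" by (rule S_spaceE) (rule that)
  then show ?thesis by (intro S_spaceI[of \<Lambda> \<nu> _ \<mu>]) (auto simp: algebra_simps)
qed

text \<open>Addition is convexity after normalisation: L(\<mu> - \<nu>) + L'(\<mu>' - \<nu>') = (L +
  L')(M - N), where M mixes \<mu> with \<mu>' and N mixes \<nu> with \<nu>', both with weights L/(L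
  + L') and L'/(L + L'). A vanishing factor is treated apart because \<open>D_space_mix\<close>
  wants both weights positive.\<close>

lemma S_space_add:
  fixes s s' :: "'a::euclidean_space set \<Rightarrow> real"
  assumes \<alpha>: "\<alpha> \<le> 1" and s: "s \<in> S_space \<alpha>" and s': "s' \<in> S_space \<alpha>"
  shows "(\<lambda>A. s A + s' A) \<in> S_space \<alpha>"
proof -
  from s obtain L \<mu> \<nu> where L: "0 \<le> L" and D: "\<mu> \<in> D_space \<alpha>" "\<nu> \<in> D_space \<alpha>"
    and s_eq: "\<And>A. s A = L * (measure \<mu> A - measure \<nu> A)" by (rule S_spaceE) (rule that)
  from s' obtain L' \<mu>' \<nu>' where L': "0 \<le> L'" and D': "\<mu>' \<in> D_space \<alpha>" "\<nu>' \<in> D_space \<alpha>"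
    and s'_eq: "\<And>A. s' A = L' * (measure \<mu>' A - measure \<nu>' A)" by (rule S_spaceE) (rule that)
  consider "L = 0" | "L' = 0" | "0 < L" "0 < L'" using L L' by linarith
  then show ?thesis
  proof cases
    case 1
    then show ?thesis using s' by (simp add: s_eq)
  next
    case 2
    then show ?thesis using s by (simp add: s'_eq)
  next
    case 3
    define t where "t = L / (L + L')"
    have t: "0 < t" "t < 1" using 3 by (auto simp: t_def)
    have sum: "(L + L') * (t * x + (1 - t) * y) = L * x + L' * y" for x y
    proof -
      have "(L + L') * t = L" using 3 by (simp add: t_def)
      moreover from this have "(L + L') * (1 - t) = L'" by (simp add: right_diff_distrib)
      ultimately show ?thesis by (simp only: distrib_left mult.assoc[symmetric])
    qed
    obtain M where M: "M \<in> D_space \<alpha>" "\<And>A. measure M A = t * measure \<mu> A + (1 - t) * measure \<mu>' A"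
      using D_space_mix[OF \<alpha> D(1) D'(1) t] by blast
    obtain N where N: "N \<in> D_space \<alpha>" "\<And>A. measure N A = t * measure \<nu> A + (1 - t) * measure \<nu>' A"
      using D_space_mix[OF \<alpha> D(2) D'(2) t] by blast
    show ?thesis
    proof (rule S_spaceI[OF _ M(1) N(1)])
      show "0 \<le> L + L'" using 3 by simp
      show "s A + s' A = (L + L') * (measure M A - measure N A)" for A
        unfolding right_diff_distrib M(2) N(2) sum by (simp add: s_eq s'_eq algebra_simps)
    qed
  qed
qed

section \<open>The ultrametric on measures\<close>

lemma dim_dist_self: "dim_dist \<mu> \<mu> = 0"
proof -
  have "dim_dist \<mu> \<mu> \<le> 0 + ennreal e" if "0 < e" for e
  proof -
    \<comment> \<open>The exponent at which \<open>1 / (1 - \<alpha>)\<close> equals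
      \<open>e\<close>; it tends to minus infinity as \<open>e\<close> tends to 0.\<close>
    have "1 - 1 / e < 1" using that by simp
    moreover have "measure_diff \<mu> \<mu> \<in> S_space (1 - 1 / e)"
      using S_space_zero[of "1 - 1 / e"] that by (simp add: measure_diff_def)
    ultimately have "dim_dist \<mu> \<mu> \<le> ennreal (1 / (1 - (1 - 1 / e)))"
      unfolding dim_dist_def by (intro INF_lower) auto
    then show ?thesis by simp
  qed
  then have "dim_dist \<mu> \<mu> \<le> 0" by (rule ennreal_le_epsilon)
  then show ?thesis by simp
qed

lemma dim_dist_commute: "dim_dist \<mu> \<nu> = dim_dist \<nu> \<mu>"
proof -
  have "measure_diff \<nu> \<mu> \<in> S_space \<alpha>" if "measure_diff \<mu> \<nu> \<in> S_space \<alpha>"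
    for \<alpha> and \<mu> \<nu> :: "'a measure"
    using S_space_uminus[OF that] by (simp add: measure_diff_def)
  then have "{\<alpha>. \<alpha> < 1 \<and> measure_diff \<mu> \<nu> \<in> S_space \<alpha>} = {\<alpha>. \<alpha> < 1 \<and> measure_diff \<nu> \<mu> \<in> S_space \<alpha>}"
    by blast
  then show ?thesis by (simp add: dim_dist_def)
qed

lemma dim_dist_ultrametric:
  fixes \<mu> \<nu> \<rho> :: "'a::euclidean_space measure"
  shows "dim_dist \<mu> \<rho> \<le> max (dim_dist \<mu> \<nu>) (dim_dist \<nu> \<rho>)"
proof (rule ccontr)
  assume "\<not> ?thesis"
  \<comment> \<open>The infima need not be attained. Strict inequality supplies exponents whose
    values lie below \<open>dim_dist \<mu> \<rho>\<close>, also when the latter is infinite.\<close>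
  then have "dim_dist \<mu> \<nu> < dim_dist \<mu> \<rho>" "dim_dist \<nu> \<rho> < dim_dist \<mu> \<rho>"
    by (simp_all add: not_le)
  then obtain \<alpha> \<beta> where \<alpha>: "\<alpha> < 1" "measure_diff \<mu> \<nu> \<in> S_space \<alpha>"
      "ennreal (1 / (1 - \<alpha>)) < dim_dist \<mu> \<rho>"
    and \<beta>: "\<beta> < 1" "measure_diff \<nu> \<rho> \<in> S_space \<beta>" "ennreal (1 / (1 - \<beta>)) < dim_dist \<mu> \<rho>"
    unfolding dim_dist_def[of \<mu> \<nu>] dim_dist_def[of \<nu> \<rho>] INF_less_iff by blast
  define \<gamma> where "\<gamma> = max \<alpha> \<beta>"
  have \<gamma>: "\<gamma> < 1" "\<alpha> \<le> \<gamma>" "\<beta> \<le> \<gamma>" using \<alpha> \<beta> by (auto simp: \<gamma>_def)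
  have "(\<lambda>A. measure_diff \<mu> \<nu> A + measure_diff \<nu> \<rho> A) \<in> S_space \<gamma>"
    using \<alpha>(2) \<beta>(2) \<gamma> S_space_mono[of \<alpha> \<gamma>] S_space_mono[of \<beta> \<gamma>] by (intro S_space_add) auto
  then have "measure_diff \<mu> \<rho> \<in> S_space \<gamma>" by (simp add: measure_diff_def)
  then have "dim_dist \<mu> \<rho> \<le> ennreal (1 / (1 - \<gamma>))"
    unfolding dim_dist_def using \<gamma> by (intro INF_lower) auto
  also have "\<dots> < dim_dist \<mu> \<rho>" using \<alpha>(3) \<beta>(3) by (auto simp: \<gamma>_def max_def)
  finally show False by simp
qed

lemma dim_dist_triangle:
  fixes \<mu> \<nu> \<rho> :: "'a::euclidean_space measure"
  shows "dim_dist \<mu> \<rho> \<le> dim_dist \<mu> \<nu> + dim_dist \<nu> \<rho>"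
  using dim_dist_ultrametric[of \<mu> \<rho> \<nu>] by (rule order_trans) (simp add: add_increasing add_increasing2)

section \<open>Passage to equivalence classes\<close>

lemma dim_rel_iff:
  "(\<mu>, \<nu>) \<in> dim_rel \<longleftrightarrow> \<mu> \<in> borel_probs \<and> \<nu> \<in> borel_probs \<and> dim_dist \<mu> \<nu> = 0"
  by (simp add: dim_rel_def)

lemma equiv_dim_rel: "equiv borel_probs (dim_rel :: ('a::euclidean_space measure \<times> 'a measure) set)"
proof (rule equivI)
  show "dim_rel \<subseteq> borel_probs \<times> (borel_probs :: 'a measure set)" by (auto simp: dim_rel_iff)
  show "refl_on borel_probs (dim_rel :: ('a measure \<times> 'a measure) set)"
    by (auto simp: refl_on_def dim_rel_iff dim_dist_self)
  show "sym (dim_rel :: ('a measure \<times> 'a measure) set)"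
    by (auto simp: sym_def dim_rel_iff dim_dist_commute)
  show "trans (dim_rel :: ('a measure \<times> 'a measure) set)"
  proof (rule transI)
    fix \<mu> \<nu> \<rho> :: "'a measure" assume "(\<mu>, \<nu>) \<in> dim_rel" "(\<nu>, \<rho>) \<in> dim_rel"
    then show "(\<mu>, \<rho>) \<in> dim_rel" using dim_dist_triangle[of \<mu> \<rho> \<nu>] by (simp add: dim_rel_iff)
  qed
qed

text \<open>The triangle inequality used twice, with both outer distances 0, gives one inequality;
  symmetry allows the same argument with the two pairs exchanged.\<close>

lemma dim_dist_cong:
  fixes \<mu> \<nu> \<mu>' \<nu>' :: "'a::euclidean_space measure"
  assumes "(\<mu>, \<mu>') \<in> dim_rel" "(\<nu>, \<nu>') \<in> dim_rel"
  shows "dim_dist \<mu>' \<nu>' = dim_dist \<mu> \<nu>"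
proof -
  have le: "dim_dist \<mu>' \<nu>' \<le> dim_dist \<mu> \<nu>" if "dim_dist \<mu> \<mu>' = 0" "dim_dist \<nu> \<nu>' = 0"
    for \<mu> \<nu> \<mu>' \<nu>' :: "'a measure"
  proof -
    have "dim_dist \<mu>' \<nu>' \<le> dim_dist \<mu>' \<mu> + dim_dist \<mu> \<nu>'" by (rule dim_dist_triangle)
    also have "dim_dist \<mu>' \<mu> = 0" using that by (subst dim_dist_commute) simp
    also have "dim_dist \<mu> \<nu>' \<le> dim_dist \<mu> \<nu> + dim_dist \<nu> \<nu>'" by (rule dim_dist_triangle)
    also have "dim_dist \<nu> \<nu>' = 0" by (rule that)
    finally show ?thesis by simp
  qed
  have *: "dim_dist \<mu> \<mu>' = 0" "dim_dist \<nu> \<nu>' = 0" using assms by (simp_all add: dim_rel_iff)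
  then have "dim_dist \<mu>' \<mu> = 0" "dim_dist \<nu>' \<nu> = 0"
    by (subst dim_dist_commute, simp)+
  then show ?thesis by (rule antisym[OF le[OF *] le])
qed

text \<open>By \<open>dim_dist_cong\<close> the set under \<open>the_elem\<close> contains only one
  value, and by reflexivity of the relation it is nonempty.\<close>

lemma class_dist_classes:
  fixes \<mu> \<nu> :: "'a::euclidean_space measure"
  assumes "\<mu> \<in> borel_probs" "\<nu> \<in> borel_probs"
  shows "class_dist (dim_rel `` {\<mu>}) (dim_rel `` {\<nu>}) = dim_dist \<mu> \<nu>"
proof -
  have nonempty: "dim_rel `` {\<mu>} \<noteq> {}" "dim_rel `` {\<nu>} \<noteq> {}"
    using assms dim_dist_self[of \<mu>] dim_dist_self[of \<nu>] by (auto simp: dim_rel_iff)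
  have "(\<Union>\<mu>'\<in>dim_rel `` {\<mu>}. \<Union>\<nu>'\<in>dim_rel `` {\<nu>}. {dim_dist \<mu>' \<nu>'})
      = (\<Union>\<mu>'\<in>dim_rel `` {\<mu>}. \<Union>\<nu>'\<in>dim_rel `` {\<nu>}. {dim_dist \<mu> \<nu>})"
    by (intro SUP_cong refl arg_cong[where f = "\<lambda>x. {x}"] dim_dist_cong) (simp_all only: Image_singleton_iff)
  also have "\<dots> = {dim_dist \<mu> \<nu>}"
    using nonempty by (simp only: UN_constant if_False)
  finally have "(\<Union>\<mu>'\<in>dim_rel `` {\<mu>}. \<Union>\<nu>'\<in>dim_rel `` {\<nu>}. {dim_dist \<mu>' \<nu>'}) = {dim_dist \<mu> \<nu>}" .
  then show ?thesis unfolding class_dist_def by (simp only: the_elem_eq)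
qed

text \<open>\<open>the_elem\<close> of a set that is not a singleton is unspecified, so the second
  conjunct, well-definedness on classes, is what gives the metric claim its intended
  meaning.\<close>

theorem theorem4p0p9:
  shows "equiv borel_probs (dim_rel :: ((real ^ 'm) measure \<times> (real ^ 'm) measure) set) \<and>
    (\<forall>\<mu>\<in>borel_probs. \<forall>\<nu>\<in>borel_probs.
      class_dist (dim_rel `` {\<mu> :: (real ^ 'm) measure}) (dim_rel `` {\<nu>}) = dim_dist \<mu> \<nu>) \<and>
    extended_metric_on
      (borel_probs // (dim_rel :: ((real ^ 'm) measure \<times> (real ^ 'm) measure) set)) class_dist"
proof (intro conjI ballI)
  show "equiv borel_probs (dim_rel :: ((real ^ 'm) measure \<times> (real ^ 'm) measure) set)"
    by (rule equiv_dim_rel)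
  show "class_dist (dim_rel `` {\<mu>}) (dim_rel `` {\<nu>}) = dim_dist \<mu> \<nu>"
    if "\<mu> \<in> borel_probs" "\<nu> \<in> borel_probs" for \<mu> \<nu> :: "(real ^ 'm) measure"
    using that by (rule class_dist_classes)
  show "extended_metric_on
      (borel_probs // (dim_rel :: ((real ^ 'm) measure \<times> (real ^ 'm) measure) set)) class_dist"
    unfolding extended_metric_on_def
  proof (intro conjI ballI)
    fix X Y assume "X \<in> borel_probs // (dim_rel :: ((real ^ 'm) measure \<times> (real ^ 'm) measure) set)"
      "Y \<in> borel_probs // (dim_rel :: ((real ^ 'm) measure \<times> (real ^ 'm) measure) set)"
    then obtain \<mu> \<nu> :: "(real ^ 'm) measure"
      where \<mu>: "\<mu> \<in> borel_probs" "X = dim_rel `` {\<mu>}" and \<nu>: "\<nu> \<in> borel_probs" "Y = dim_rel `` {\<nu>}"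
      by (elim quotientE) (rule that)
    \<comment> \<open>Classes coincide exactly when their representatives are related, and the
      relation is distance 0 by definition.\<close>
    show "class_dist X Y = 0 \<longleftrightarrow> X = Y"
      using \<mu> \<nu> eq_equiv_class_iff[OF equiv_dim_rel, of \<mu> \<nu>]
      by (simp add: class_dist_classes dim_rel_iff)
    show "class_dist X Y = class_dist Y X"
      using \<mu> \<nu> by (simp add: class_dist_classes dim_dist_commute)
    fix Z assume "Z \<in> borel_probs // (dim_rel :: ((real ^ 'm) measure \<times> (real ^ 'm) measure) set)"
    then obtain \<rho> :: "(real ^ 'm) measure" where "\<rho> \<in> borel_probs" "Z = dim_rel `` {\<rho>}"
      by (elim quotientE) (rule that)
    then show "class_dist X Z \<le> class_dist X Y + class_dist Y Z"
      using \<mu> \<nu> dim_dist_triangle by (simp add: class_dist_classes)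
  qed
qed

end
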